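(* Let $p$ be a prime and let $A\in\operatorname{SL}(2,p)$ be diagonalisable with both eigenvalues in $\mathbb F_{p^2}^*\setminus\mathbb F_p$. Let $\tau$ be the multiplicative order of $A$, and let $F_{2,p}(A)$ be the number of $6$-tuples of integers $(x_1,\ldots,x_6)$ with $1\le x_1,\ldots,x_6\le\tau$ such that $$A^{x_1}+A^{x_2}+A^{x_3}=A^{x_4}+A^{x_5}+A^{x_6}.$$ Then $$F_{2,p}(A)\ll \tau^{19/5}+\tau^5p^{-1},$$ with an absolute implied constant.
   Context: $\operatorname{SL}(2,p)$ is the group of $2\times 2$ matrices of determinant $1$ over $\mathbb F_p$. The multiplicative order of $A$ is the least $\tau\ge 1$ with $A^\tau=I$. $U\ll V$ means $|U|\le cV$ for some constant $c>0$. *)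

theory Defs
  imports "HOL-Number_Theory.Number_Theory"
begin

datatype 'a mat2 = Mat2 'a 'a 'a 'a

text \<open>
  The prime is a value rather than a type here, because an absolute constant has to be
  quantified outside it. Matrices therefore have their entries in an explicit ring structure.
  \<open>Mat2 a b c d\<close> lists the entries row by row.
\<close>

fun mat2_add :: "('a, 'm) ring_scheme \<Rightarrow> 'a mat2 \<Rightarrow> 'a mat2 \<Rightarrow> 'a mat2" where
  "mat2_add R (Mat2 a b c d) (Mat2 a' b' c' d') =
     Mat2 (a \<oplus>\<^bsub>R\<^esub> a') (b \<oplus>\<^bsub>R\<^esub> b') (c \<oplus>\<^bsub>R\<^esub> c') (d \<oplus>\<^bsub>R\<^esub> d')"

fun mat2_mult :: "('a, 'm) ring_scheme \<Rightarrow> 'a mat2 \<Rightarrow> 'a mat2 \<Rightarrow> 'a mat2" where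
  "mat2_mult R (Mat2 a b c d) (Mat2 a' b' c' d') =
     Mat2 (a \<otimes>\<^bsub>R\<^esub> a' \<oplus>\<^bsub>R\<^esub> b \<otimes>\<^bsub>R\<^esub> c') (a \<otimes>\<^bsub>R\<^esub> b' \<oplus>\<^bsub>R\<^esub> b \<otimes>\<^bsub>R\<^esub> d')
          (c \<otimes>\<^bsub>R\<^esub> a' \<oplus>\<^bsub>R\<^esub> d \<otimes>\<^bsub>R\<^esub> c') (c \<otimes>\<^bsub>R\<^esub> b' \<oplus>\<^bsub>R\<^esub> d \<otimes>\<^bsub>R\<^esub> d')"

fun mat2_det :: "('a, 'm) ring_scheme \<Rightarrow> 'a mat2 \<Rightarrow> 'a" where
  "mat2_det R (Mat2 a b c d) = a \<otimes>\<^bsub>R\<^esub> d \<ominus>\<^bsub>R\<^esub> b \<otimes>\<^bsub>R\<^esub> c"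

fun mat2_apply :: "('a, 'm) ring_scheme \<Rightarrow> 'a mat2 \<Rightarrow> 'a \<times> 'a \<Rightarrow> 'a \<times> 'a" where
  "mat2_apply R (Mat2 a b c d) (x, y) =
     (a \<otimes>\<^bsub>R\<^esub> x \<oplus>\<^bsub>R\<^esub> b \<otimes>\<^bsub>R\<^esub> y, c \<otimes>\<^bsub>R\<^esub> x \<oplus>\<^bsub>R\<^esub> d \<otimes>\<^bsub>R\<^esub> y)"

definition mat2_diag :: "('a, 'm) ring_scheme \<Rightarrow> 'a \<Rightarrow> 'a \<Rightarrow> 'a mat2" where
  "mat2_diag R l m = Mat2 l \<zero>\<^bsub>R\<^esub> \<zero>\<^bsub>R\<^esub> m"

definition mat2_ring :: "('a, 'm) ring_scheme \<Rightarrow> 'a mat2 ring" where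
  "mat2_ring R =
     \<lparr>carrier = {A. set_mat2 A \<subseteq> carrier R},
      monoid.mult = mat2_mult R,
      one = mat2_diag R \<one>\<^bsub>R\<^esub> \<one>\<^bsub>R\<^esub>,
      zero = mat2_diag R \<zero>\<^bsub>R\<^esub> \<zero>\<^bsub>R\<^esub>,
      add = mat2_add R\<rparr>"

definition SL2 :: "('a, 'm) ring_scheme \<Rightarrow> 'a mat2 set" where
  "SL2 R = {A \<in> carrier (mat2_ring R). mat2_det R A = \<one>\<^bsub>R\<^esub>}"

definition mat2_eigenvalue :: "('a, 'm) ring_scheme \<Rightarrow> 'a mat2 \<Rightarrow> 'a \<Rightarrow> bool" where
  "mat2_eigenvalue K A l \<longleftrightarrow> l \<in> carrier K \<and>
     (\<exists>x \<in> carrier K. \<exists>y \<in> carrier K. (x, y) \<noteq> (\<zero>\<^bsub>K\<^esub>, \<zero>\<^bsub>K\<^esub>) \<and>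
        mat2_apply K A (x, y) = (l \<otimes>\<^bsub>K\<^esub> x, l \<otimes>\<^bsub>K\<^esub> y))"

definition mat2_diagonalisable :: "('a, 'm) ring_scheme \<Rightarrow> 'a mat2 \<Rightarrow> bool" where
  "mat2_diagonalisable K A \<longleftrightarrow>
     (\<exists>P \<in> Units (mat2_ring K). \<exists>l \<in> carrier K. \<exists>m \<in> carrier K.
        inv\<^bsub>mat2_ring K\<^esub> P \<otimes>\<^bsub>mat2_ring K\<^esub> A \<otimes>\<^bsub>mat2_ring K\<^esub> P = mat2_diag K l m)"

definition mat2_order :: "('a, 'm) ring_scheme \<Rightarrow> 'a mat2 \<Rightarrow> nat" where
  "mat2_order R A =
     (LEAST t. 1 \<le> t \<and> A [^]\<^bsub>mat2_ring R\<^esub> t = \<one>\<^bsub>mat2_ring R\<^esub>)"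

abbreviation Fp :: "nat \<Rightarrow> int ring" where
  "Fp p \<equiv> residue_ring (int p)"

definition F2 :: "nat \<Rightarrow> int mat2 \<Rightarrow> nat" where
  "F2 p A = (let M = mat2_ring (Fp p); \<tau> = mat2_order (Fp p) A in
     card {(x1 :: nat, x2 :: nat, x3 :: nat, x4 :: nat, x5 :: nat, x6 :: nat).
       {x1, x2, x3, x4, x5, x6} \<subseteq> {1..\<tau>} \<and>
       A [^]\<^bsub>M\<^esub> x1 \<oplus>\<^bsub>M\<^esub> A [^]\<^bsub>M\<^esub> x2 \<oplus>\<^bsub>M\<^esub> A [^]\<^bsub>M\<^esub> x3 =
       A [^]\<^bsub>M\<^esub> x4 \<oplus>\<^bsub>M\<^esub> A [^]\<^bsub>M\<^esub> x5 \<oplus>\<^bsub>M\<^esub> A [^]\<^bsub>M\<^esub> x6})"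

text \<open>
  \<open>K\<close>, with the embedding \<open>h\<close>, is a model of the field with \<open>p\<^sup>2\<close> elements as an
  extension of \<open>Fp p\<close>; the subfield \<open>Fp p\<close> of \<open>K\<close> is \<open>h ` carrier (Fp p)\<close>.
  Since finite fields are unique up to isomorphism and every finite set injects
  into the integers, carriers inside \<open>int\<close> lose no generality; a type variable in
  place of \<open>int\<close> would let a constant depend on the type.
\<close>

definition quadratic_extension :: "nat \<Rightarrow> int ring \<Rightarrow> (int \<Rightarrow> int) \<Rightarrow> bool" where
  "quadratic_extension p K h \<longleftrightarrow>
     field K \<and> card (carrier K) = p ^ 2 \<and> h \<in> ring_hom (Fp p) K"

end

theory Submission
  imports Defs "HOL-Computational_Algebra.Polynomial"
begin

text \<open>
  Diagonalising \<open>A\<close>, with eigenvalues \<open>l\<close> and \<open>1/l\<close> and order \<open>t\<close>, turns the matrix equation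
  into equality of the sums and of the sums of inverses of two triples of \<open>t\<close>-th roots of
  unity. For given \<open>c\<close>, \<open>d\<close> the solutions of \<open>x + y + z = c\<close>, \<open>1/x + 1/y + 1/z = d\<close> are, outside
  \<open>O(t^2)\<close> degenerate triples, at most two for each \<open>z\<close>, and \<open>z\<close> and its Moebius image
  \<open>(c - z) / (d z - 1)\<close> are both \<open>t\<close>-th roots of unity. Stepanov's method bounds the number of
  such \<open>z\<close> by \<open>O(t^(2/3) + t^2/p)\<close>. Its auxiliary polynomial is nonzero because, in the Moebius
  coordinate, its vanishing would make a sparse polynomial vanish too often at a nonzero point.
  Summing over the triples gives \<open>O(t^(11/3) + t^5/p)\<close>.
\<close>

section \<open>Vanishing orders of polynomials over a field\<close>

text \<open>Gaussian elimination, one equation per induction step; \<open>I\<close> indexes the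
  unknowns, \<open>J\<close> the equations. It supplies the coefficients of the auxiliary
  polynomial.\<close>

lemma exists_nontrivial_solution:
  fixes c :: "'i \<Rightarrow> 'j \<Rightarrow> 'a::field"
  assumes "finite J" "finite I" "card J < card I"
  shows "\<exists>l. (\<exists>i\<in>I. l i \<noteq> 0) \<and> (\<forall>j\<in>J. (\<Sum>i\<in>I. l i * c i j) = 0)"
  using assms
proof (induction J arbitrary: c I rule: finite_induct)
  case empty
  then have "I \<noteq> {}" by auto
  then show ?case by (intro exI[of _ "\<lambda>_. 1"]) auto
next
  case (insert j0 J)
  show ?case
  proof (cases "\<forall>i\<in>I. c i j0 = 0")
    case True
    have "card J < card I" using insert by simp
    from insert.IH[OF insert.prems(1) this] obtain l
      where "\<exists>i\<in>I. l i \<noteq> 0" "\<forall>j\<in>J. (\<Sum>i\<in>I. l i * c i j) = 0" by blast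
    with True show ?thesis by (intro exI[of _ l]) auto
  next
    case False
    then obtain i0 where i0: "i0 \<in> I" "c i0 j0 \<noteq> 0" by blast
    define I' where "I' = I - {i0}"
    have I': "finite I'" "i0 \<notin> I'" "I = insert i0 I'" using insert.prems i0 by (auto simp: I'_def)
    have "card J < card I'" using insert I' by simp
    \<comment> \<open>Equation \<open>j0\<close> is solved for the unknown \<open>i0\<close> and
      substituted into the others.\<close>
    from insert.IH[OF I'(1) this, of "\<lambda>i j. c i j - c i j0 / c i0 j0 * c i0 j"] obtain l where
      l: "\<exists>i\<in>I'. l i \<noteq> 0"
         "\<And>j. j \<in> J \<Longrightarrow> (\<Sum>i\<in>I'. l i * (c i j - c i j0 / c i0 j0 * c i0 j)) = 0" by blast
    define l' where "l' = l(i0 := - (\<Sum>i\<in>I'. l i * c i j0) / c i0 j0)"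
    have sum: "(\<Sum>i\<in>I. l' i * c i j) =
        (\<Sum>i\<in>I'. l i * c i j) - (\<Sum>i\<in>I'. l i * c i j0) / c i0 j0 * c i0 j" for j
    proof -
      have "(\<Sum>i\<in>I'. l' i * c i j) = (\<Sum>i\<in>I'. l i * c i j)"
        using I' by (intro sum.cong) (auto simp: l'_def)
      then show ?thesis using I' by (simp add: l'_def)
    qed
    have "(\<Sum>i\<in>I. l' i * c i j) = 0" if "j \<in> J" for j
    proof -
      have "(\<Sum>i\<in>I'. l i * (c i j - c i j0 / c i0 j0 * c i0 j)) =
        (\<Sum>i\<in>I'. l i * c i j) - (\<Sum>i\<in>I'. l i * c i j0) / c i0 j0 * c i0 j"
        by (simp add: right_diff_distrib sum_subtractf sum_divide_distrib sum_distrib_right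
            mult.assoc)
      with l(2)[OF that] sum show ?thesis by simp
    qed
    moreover have "(\<Sum>i\<in>I. l' i * c i j0) = 0" using sum i0 by simp
    moreover have "\<exists>i\<in>I. l' i \<noteq> 0" using l(1) I' unfolding l'_def by (metis fun_upd_other insertCI)
    ultimately show ?thesis by (intro exI[of _ l']) auto
  qed
qed

lemma of_nat_eq_iff_less_CHAR:
  assumes "m < CHAR('a::field)" "n < CHAR('a)"
  shows "(of_nat m = (of_nat n :: 'a)) \<longleftrightarrow> m = n"
proof -
  have *: "i = j" if "i \<le> j" "j < CHAR('a)" "of_nat i = (of_nat j :: 'a)" for i j
  proof -
    have "of_nat (j - i) = (0 :: 'a)" using that by (simp add: of_nat_diff)
    then have "CHAR('a) dvd j - i" by (simp add: of_nat_eq_0_iff_char_dvd)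
    then show ?thesis using that dvd_imp_le[of "CHAR('a)" "j - i"] by (cases "i = j") auto
  qed
  show ?thesis using *[of m n] *[of n m] assms by (metis linorder_linear)
qed

lemma linear_power_dvd_pderiv:
  fixes f :: "'a::field poly"
  assumes "[:-a, 1:] ^ Suc n dvd f"
  shows "[:-a, 1:] ^ n dvd pderiv f"
proof -
  obtain g where "f = [:-a, 1:] ^ Suc n * g" using assms by blast
  then have "pderiv f = [:-a, 1:] ^ n * ([:-a, 1:] * pderiv g + smult (of_nat (Suc n)) g)"
    by (simp add: pderiv_mult pderiv_power_Suc pderiv_pCons algebra_simps del: power_Suc of_nat_Suc)
       (simp add: algebra_simps)
  then show ?thesis by simp
qed

text \<open>The factor \<open>X * Y\<close> restores the exponents that differentiation lowers, so
  the rule also covers \<open>e = 0\<close> and \<open>r = 0\<close>.\<close>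

lemma pderiv_two_powers:
  fixes X Y :: "'a::field poly"
  shows "X * Y * pderiv (X ^ e * Y ^ r) =
    X ^ e * Y ^ r * (of_nat e * Y * pderiv X + of_nat r * X * pderiv Y)"
proof -
  have *: "X * pderiv (X ^ e) = of_nat e * X ^ e * pderiv X" for e and X :: "'a poly"
  proof (cases e)
    case (Suc n)
    then show ?thesis
      by (simp add: pderiv_power_Suc of_nat_poly del: power_Suc of_nat_Suc)
         (simp add: algebra_simps)
  qed simp
  have "X * Y * pderiv (X ^ e * Y ^ r) =
      X ^ e * X * (Y * pderiv (Y ^ r)) + Y ^ r * Y * (X * pderiv (X ^ e))"
    by (simp add: pderiv_mult ring_distribs mult_ac)
  then show ?thesis unfolding * by (simp add: ring_distribs mult_ac)
qed

text \<open>Each application removes one factor \<open>[:-s, 1:]\<close> and multiplies the value of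
  the cofactor at \<open>s\<close> by the current exponent and \<open>poly V s\<close>; the other
  term of the product rule still vanishes at \<open>s\<close>.\<close>

lemma iterated_derivation:
  fixes V g :: "'a::field poly"
  assumes "m \<le> n"
  shows "\<exists>g'. ((\<lambda>f. V * pderiv f) ^^ m) ([:-s, 1:] ^ n * g) = [:-s, 1:] ^ (n - m) * g' \<and>
    poly g' s = (\<Prod>i<m. of_nat (n - i)) * poly V s ^ m * poly g s"
  using assms
proof (induction m)
  case 0
  then show ?case by simp
next
  case (Suc m)
  then obtain g' where g': "((\<lambda>f. V * pderiv f) ^^ m) ([:-s, 1:] ^ n * g) = [:-s, 1:] ^ (n - m) * g'"
    "poly g' s = (\<Prod>i<m. of_nat (n - i)) * poly V s ^ m * poly g s" by auto
  obtain r where r: "n - m = Suc r" using Suc.prems by (metis Suc_diff_Suc Suc_le_lessD)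
  then have r': "n - Suc m = r" by simp
  have "V * pderiv ([:-s, 1:] ^ Suc r * g') =
      [:-s, 1:] ^ r * (V * (smult (of_nat (Suc r)) g' + [:-s, 1:] * pderiv g'))"
    by (simp add: pderiv_mult pderiv_power_Suc pderiv_pCons algebra_simps del: power_Suc of_nat_Suc)
       (simp add: algebra_simps)
  then show ?case
    by (intro exI[of _ "V * (smult (of_nat (Suc r)) g' + [:-s, 1:] * pderiv g')"])
       (simp add: g' r r' del: of_nat_Suc power_Suc, simp add: algebra_simps)
qed

text \<open>If \<open>f = [:-s, 1:] ^ M * g\<close>, the \<open>M\<close>-th iterate at
  \<open>s\<close> is \<open>M!\<close> times \<open>poly V s ^ M * poly g s\<close>. The factorial
  is nonzero for \<open>M\<close> below the characteristic, so \<open>g\<close> has a root at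
  \<open>s\<close>.\<close>

lemma linear_power_dvdI:
  fixes V f :: "'a::field poly"
  assumes "M \<le> CHAR('a)" "poly V s \<noteq> 0"
    and "\<And>m. m < M \<Longrightarrow> poly (((\<lambda>f. V * pderiv f) ^^ m) f) s = 0"
  shows "[:-s, 1:] ^ M dvd f"
  using assms(1,3)
proof (induction M)
  case 0
  then show ?case by simp
next
  case (Suc M)
  then obtain g where g: "f = [:-s, 1:] ^ M * g" by (auto simp: dvd_def)
  obtain g' where g': "((\<lambda>f. V * pderiv f) ^^ M) f = g'"
    "poly g' s = (\<Prod>i<M. of_nat (M - i)) * poly V s ^ M * poly g s"
    using iterated_derivation[of M M V s g] g by auto
  have "of_nat (M - i) \<noteq> (0 :: 'a)" if "i < M" for i
    using of_nat_eq_iff_less_CHAR[of "M - i" 0, where 'a = 'a] Suc.prems that by simp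
  then have "(\<Prod>i<M. of_nat (M - i)) * poly V s ^ M \<noteq> (0 :: 'a)" using assms(2) by simp
  then have "poly g s = 0" using g' Suc.prems(2)[of M] by auto
  then have "[:-s, 1:] dvd g" by (simp add: poly_eq_0_iff_dvd)
  then show ?case unfolding g power_Suc2 by (rule mult_dvd_mono[OF dvd_refl])
qed

lemma card_mult_le_degree:
  fixes f :: "'a::field poly"
  assumes "f \<noteq> 0" "M > 0" "\<And>s. s \<in> S \<Longrightarrow> [:-s, 1:] ^ M dvd f"
  shows "M * card S \<le> degree f"
proof -
  have ord: "M \<le> order s f" if "s \<in> S" for s
    using assms(1) assms(3)[OF that] order_divides by blast
  then have sub: "S \<subseteq> {x. poly f x = 0}" using assms(2)
    by (force simp: order_root assms(1))
  have fin: "finite {x. poly f x = 0}" using assms(1) by (rule poly_roots_finite)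
  have "M * card S = (\<Sum>s\<in>S. M)" by simp
  also have "\<dots> \<le> (\<Sum>s\<in>S. order s f)" by (rule sum_mono) (rule ord)
  also have "\<dots> \<le> (\<Sum>s | poly f s = 0. order s f)"
    using sub fin by (intro sum_mono2) auto
  also have "\<dots> \<le> degree f" using assms(1) by (rule sum_order_le_degree)
  finally show ?thesis .
qed

section \<open>Stepanov's method for a Moebius transformation\<close>

text \<open>
  In the coordinate \<open>(c - z) / (d z - 1)\<close> this says that a sparse polynomial vanishes at
  a nonzero point to an order less than its number of terms.
\<close>

lemma sparse_vanishing:
  fixes c d :: "'a::field"
  defines "X \<equiv> [:c, -1:]" and "Y \<equiv> [:-1, d:]"
  assumes c: "c \<noteq> 0" and cd: "c * d \<noteq> 1" and E: "E < CHAR('a)"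
    and "finite I" "I \<subseteq> {..E}"
    and "[:0, 1:] ^ card I dvd (\<Sum>e\<in>I. smult (l e) (X ^ e * Y ^ (E - e)))"
    and "e \<in> I"
  shows "l e = 0"
  using assms(6-9)
proof (induction I arbitrary: l e rule: finite_induct)
  case empty
  then show ?case by simp
next
  case (insert e0 I)
  define k where "k = c * d - 1"
  define F where "F e = X ^ e * Y ^ (E - e)" for e
  define Q where "Q = (\<Sum>e\<in>insert e0 I. smult (l e) (F e))"
  \<comment> \<open>\<open>T\<close> is diagonal on the \<open>F e\<close> with eigenvalue zero at
    \<open>e0\<close>, because \<open>Y + smult d X\<close> is the constant \<open>k\<close>. It
    removes one term and, being of first order, costs at most one order of vanishing at 0.\<close>
  define T where "T f = X * Y * pderiv f - smult (of_nat E * d) X * f + smult (of_nat e0 * k) f" for f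
  have T_F: "T (F e) = smult ((of_nat e0 - of_nat e) * k) (F e)" if "e \<le> E" for e
  proof -
    have 1: "Y = [:k:] - smult d X" by (simp add: X_def Y_def k_def)
    have 2: "pderiv X = [:-1:]" "pderiv Y = [:d:]" by (simp_all add: X_def Y_def pderiv_pCons)
    have 3: "of_nat (E - e) = [:of_nat E - of_nat e :: 'a:]"
      using that unfolding of_nat_poly by (simp add: of_nat_diff)
    have "X * Y * pderiv (F e) = F e * (of_nat e * Y * pderiv X + of_nat (E - e) * X * pderiv Y)"
      unfolding F_def by (rule pderiv_two_powers)
    also have "\<dots> = smult (of_nat E * d) X * F e - smult (of_nat e * k) (F e)"
      unfolding 2 3 unfolding of_nat_poly 1 by (simp add: algebra_simps smult_diff_left)
    finally show ?thesis unfolding T_def by (simp add: algebra_simps smult_diff_left)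
  qed
  have T_smult: "T (smult a f) = smult a (T f)" for a f
    by (simp add: T_def pderiv_smult algebra_simps smult_add_right smult_diff_right)
  have T_add: "T (f + g) = T f + T g" for f g
    by (simp add: T_def pderiv_add algebra_simps smult_add_right)
  have T_sum: "T (\<Sum>e\<in>J. smult (l e) (F e)) = (\<Sum>e\<in>J. smult (l e) (T (F e)))"
    if "finite J" for J
    using that by (induction J) (simp_all add: T_add T_smult, simp add: T_def)
  have "T Q = (\<Sum>e\<in>insert e0 I. smult (l e * ((of_nat e0 - of_nat e) * k)) (F e))"
    unfolding Q_def using insert.hyps insert.prems(1)
    by (subst T_sum) (auto intro!: sum.cong simp: T_F)
  also have "\<dots> = (\<Sum>e\<in>I. smult (l e * ((of_nat e0 - of_nat e) * k)) (F e))"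
    using insert.hyps by simp
  finally have TQ: "T Q = \<dots>" .
  have dvdQ: "[:0, 1:] ^ Suc (card I) dvd Q"
    using insert.prems(2) insert.hyps unfolding Q_def F_def by (simp del: power_Suc)
  then have "[:0, 1:] ^ card I dvd Q" by (meson dvd_trans le_imp_power_dvd lessI less_imp_le)
  moreover have "[:0, 1:] ^ card I dvd pderiv Q"
    using linear_power_dvd_pderiv[of 0 "card I" Q] dvdQ by simp
  ultimately have "[:0, 1:] ^ card I dvd T Q"
    unfolding T_def by (intro dvd_add dvd_diff) (auto intro: dvd_smult)
  then have IH: "l e * ((of_nat e0 - of_nat e) * k) = 0" if "e \<in> I" for e
    using insert.IH[of "\<lambda>e. l e * ((of_nat e0 - of_nat e) * k)" e] insert.prems(1) that
    unfolding TQ F_def by auto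
  have l0: "l e = 0" if "e \<in> I" for e
  proof -
    have "of_nat e0 \<noteq> (of_nat e :: 'a)"
      using that insert.hyps insert.prems(1) E
      by (subst of_nat_eq_iff_less_CHAR) auto
    then show ?thesis using IH[OF that] cd by (auto simp: k_def)
  qed
  \<comment> \<open>Only the term \<open>e0\<close> survives, and \<open>F e0\<close> is nonzero at
    0, where \<open>X\<close> is \<open>c\<close> and \<open>Y\<close> is \<open>-1\<close>.\<close>
  then have "Q = smult (l e0) (F e0)" unfolding Q_def using insert.hyps by simp
  moreover have "poly Q 0 = 0"
    using dvdQ by (metis dvd_mult_left minus_zero poly_eq_0_iff_dvd power_Suc)
  ultimately have "l e0 = 0" using c by (simp add: F_def X_def Y_def)
  then show ?case using l0 insert.prems(3) by auto
qed

section \<open>Degrees under iterated derivations\<close>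

lemma degree_pderiv_le_pred:
  fixes f :: "'a::field poly"
  shows "degree (pderiv f) \<le> degree f - 1"
  by (rule degree_le) (auto simp: coeff_pderiv coeff_eq_0)

lemma pderiv_sum_smult:
  fixes F :: "'i \<Rightarrow> 'a::field poly"
  shows "pderiv (\<Sum>q\<in>I. smult (l q) (F q)) = (\<Sum>q\<in>I. smult (l q) (pderiv (F q)))"
  by (induction I rule: infinite_finite_induct) (simp_all add: pderiv_add pderiv_smult)

text \<open>A cofactor \<open>h\<close> of \<open>F\<close> passes to
  \<open>V * pderiv h + W * h\<close>, which raises the degree by at most two.\<close>

lemma iterated_derivation_eigen:
  fixes V W F :: "'a::field poly"
  assumes "V * pderiv F = W * F" "degree V \<le> 3" "degree W \<le> 2"
  shows "\<exists>h. ((\<lambda>f. V * pderiv f) ^^ m) F = F * h \<and> degree h \<le> 2 * m"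
proof (induction m)
  case 0
  then show ?case by (intro exI[of _ 1]) simp
next
  case (Suc m)
  then obtain h where h: "((\<lambda>f. V * pderiv f) ^^ m) F = F * h" "degree h \<le> 2 * m" by blast
  have "V * pderiv (F * h) = F * (V * pderiv h) + h * (V * pderiv F)"
    by (simp add: pderiv_mult ring_distribs mult_ac)
  also have "\<dots> = F * (V * pderiv h + W * h)"
    unfolding assms(1) by (simp add: ring_distribs mult_ac)
  finally have eq: "V * pderiv (F * h) = F * (V * pderiv h + W * h)" .
  \<comment> \<open>Constant \<open>h\<close> is separate: there \<open>degree h - 1\<close> is
    truncated to 0 and the general estimate would only give 3.\<close>
  have "degree (V * pderiv h) \<le> 2 * Suc m"
  proof (cases "degree h = 0")
    case True
    then have "pderiv h = 0" by (metis degree_eq_zeroE pderiv_singleton)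
    then show ?thesis by simp
  next
    case False
    have "degree (V * pderiv h) \<le> 3 + (degree h - 1)"
      using degree_mult_le[of V "pderiv h"] degree_pderiv_le_pred[of h] assms(2) by linarith
    then show ?thesis using False h(2) by arith
  qed
  moreover have "degree (W * h) \<le> 2 * Suc m"
    using degree_mult_le[of W h] assms(3) h(2) by simp
  ultimately have "degree (V * pderiv h + W * h) \<le> 2 * Suc m" by (rule degree_add_le)
  then show ?case using eq h(1) by auto
qed

lemma iterated_derivation_sum:
  fixes V :: "'a::field poly"
  shows "((\<lambda>f. V * pderiv f) ^^ m) (\<Sum>q\<in>I. smult (l q) (F q)) =
    (\<Sum>q\<in>I. smult (l q) (((\<lambda>f. V * pderiv f) ^^ m) (F q)))"
  by (induction m) (simp_all add: pderiv_sum_smult sum_distrib_left)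

lemma div_mod_box:
  fixes t A B :: nat
  assumes "0 < A" "A \<le> t"
  shows "card {e. e mod t < A \<and> e div t < B} = A * B" "finite {e. e mod t < A \<and> e div t < B}"
proof -
  have "bij_betw (\<lambda>e. (e mod t, e div t)) {e. e mod t < A \<and> e div t < B} ({..<A} \<times> {..<B})"
    by (rule bij_betw_byWitness[where f' = "\<lambda>(a, j). a + t * j"]) (use assms in auto)
  from bij_betw_same_card[OF this] bij_betw_finite[OF this]
  show "card {e. e mod t < A \<and> e div t < B} = A * B" "finite {e. e mod t < A \<and> e div t < B}"
    by simp_all
qed

text \<open>For \<open>n = A\<close> this counts the linear conditions of the construction,
  \<open>2 * A ^ 2 - A\<close> in total.\<close>

lemma sum_arithmetic_bound:
  fixes A :: nat
  shows "(\<Sum>m<n. A + 2 * m) + n = A * n + n ^ 2"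
  by (induction n) (simp_all add: power2_eq_square algebra_simps)

text \<open>
  The exponents \<open>e\<close> with \<open>e mod t < A\<close> and \<open>e div t < B\<close> stand for
  \<open>X ^ a * (X ^ t) ^ j\<close> with \<open>a < A\<close>, \<open>j < B\<close>.
\<close>

lemma stepanov_nonzero:
  fixes c d :: "'a::field"
  defines "X \<equiv> [:c, -1:]" and "Y \<equiv> [:-1, d:]"
  assumes c: "c \<noteq> 0" and cd: "c * d \<noteq> 1" and E: "E < CHAR('a)"
    and A: "0 < A" "A * B \<le> t" and Ie: "{e. e mod t < A \<and> e div t < B} \<subseteq> {..E}"
    and zero: "(\<Sum>(i, e)\<in>{..<B} \<times> {e. e mod t < A \<and> e div t < B}.
      smult (l (i, e)) ([:0, 1:] ^ (t * i) * (X ^ e * Y ^ (E - e)))) = 0"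
    and "i < B" "e mod t < A" "e div t < B"
  shows "l (i, e) = 0"
  using assms(10-12)
proof (induction i arbitrary: e rule: less_induct)
  case (less i)
  define I where "I = {e. e mod t < A \<and> e div t < B}"
  define Z :: "'a poly" where "Z = [:0, 1:]"
  define Q where "Q i = (\<Sum>e\<in>I. smult (l (i, e)) (X ^ e * Y ^ (E - e)))" for i
  have "A \<le> t" using A less.prems(1) by (cases B) auto
  then have I: "finite I" "card I = A * B" unfolding I_def using div_mod_box A by auto
  have "(\<Sum>i<B. Z ^ (t * i) * Q i) = 0"
    using zero unfolding Q_def I_def[symmetric] Z_def[symmetric] sum.cartesian_product[symmetric]
    by (simp add: sum_distrib_left)
  \<comment> \<open>Terms with smaller index are zero by induction and later ones carry higher
    powers of \<open>Z\<close>, so \<open>Q i\<close> itself is divisible by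
    \<open>Z ^ t\<close>.\<close>
  then have "Z ^ (t * i) * Q i = - (\<Sum>i'\<in>{..<B} - {i}. Z ^ (t * i') * Q i')"
    using less.prems(1) by (subst (asm) sum.remove[of _ i]) (auto simp: eq_neg_iff_add_eq_0)
  also have "Z ^ (t * Suc i) dvd \<dots>"
  proof -
    have "Z ^ (t * Suc i) dvd Z ^ (t * i') * Q i'" if "i' \<in> {..<B} - {i}" for i'
    proof (cases "i' < i")
      case True
      then have "Q i' = 0" unfolding Q_def using less.IH that by (simp add: I_def)
      then show ?thesis by simp
    next
      case False
      then have "t * Suc i \<le> t * i'" using that by (intro mult_le_mono2) auto
      then show ?thesis by (intro dvd_mult2 le_imp_power_dvd)
    qed
    then show ?thesis unfolding dvd_minus_iff by (rule dvd_sum)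
  qed
  finally have "Z ^ (t * i) * Z ^ t dvd Z ^ (t * i) * Q i" by (simp add: power_add mult.commute)
  then have "Z ^ t dvd Q i" by (simp add: Z_def)
  \<comment> \<open>By \<open>A * B \<le> t\<close> the vanishing order reaches the number of terms,
    as \<open>sparse_vanishing\<close> asks.\<close>
  then have "Z ^ card I dvd Q i" using A I by (metis dvd_trans le_imp_power_dvd)
  then show ?case
    using sparse_vanishing[OF c cd E I(1), of "\<lambda>e. l (i, e)" e] Ie less.prems
    unfolding Q_def X_def Y_def I_def Z_def by simp
qed

text \<open>A nonzero polynomial \<open>\<Phi>\<close> is built that vanishes to order
  \<open>A\<close> at every point of the set; its degree then bounds \<open>A\<close> times the
  cardinality.\<close>

lemma stepanov_bound:
  fixes c d :: "'a::field"
  assumes c: "c \<noteq> 0" and cd: "c * d \<noteq> 1" and b: "b > 0"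
    and bt: "4 * b ^ 3 \<le> t" and btp: "2 * b * t \<le> CHAR('a)"
  shows "b * card {s::'a. s ^ t = 1 \<and> (c - s) ^ t = (d * s - 1) ^ t \<and> s \<noteq> c} \<le> 2 * t"
proof -
  \<comment> \<open>Since \<open>B * B = 2 * A\<close>, the \<open>2 * A ^ 2\<close> unknowns
    outnumber the \<open>2 * A ^ 2 - A\<close> conditions. Moreover \<open>A * B = 4 * b ^ 3\<close>
    is at most \<open>t\<close>, and \<open>E\<close>, the largest exponent in \<open>I\<close>, is
    below \<open>2 * b * t\<close>.\<close>
  define A B E where "A = 2 * b ^ 2" and "B = 2 * b" and "E = A - 1 + t * (B - 1)"
  define X Y Z V where "X = [:c, -1:]" and "Y = [:-1, d:]" and "Z = [:0, 1 :: 'a:]"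
    and "V = Z * (X * Y)"
  define I where "I = {e. e mod t < A \<and> e div t < B}"
  define S where "S = {s::'a. s ^ t = 1 \<and> (c - s) ^ t = (d * s - 1) ^ t \<and> s \<noteq> c}"
  have AB: "A * B \<le> t" using bt by (simp add: A_def B_def power2_eq_square power3_eq_cube mult_ac)
  have A: "A > 0" and B: "B > 0" using b by (simp_all add: A_def B_def)
  have At: "A \<le> t"
    using AB B by (metis le_trans mult.commute mult_le_mono1 nat_mult_1 Suc_leI One_nat_def)
  have t: "t > 0" using A At by simp
  have "t * B = t * (B - 1) + t" using B by (cases B) auto
  then have EB: "E < t * B" using A At by (simp add: E_def)
  then have E: "E < CHAR('a)" using btp by (simp add: B_def mult_ac)
  have AE: "A \<le> E + 1" using A by (simp add: E_def)
  have card_I: "card I = A * B" and fin_I: "finite I"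
    unfolding I_def using div_mod_box A At by auto
  have e_split: "e mod t \<le> A - 1" "e div t \<le> B - 1" "e = e mod t + t * (e div t)" "e \<le> E"
    if "e \<in> I" for e
  proof -
    show 1: "e mod t \<le> A - 1" "e div t \<le> B - 1" "e = e mod t + t * (e div t)"
      using that by (auto simp: I_def)
    have "t * (e div t) \<le> t * (B - 1)" using 1 by simp
    then show "e \<le> E" using 1 unfolding E_def by linarith
  qed

  define F where "F = (\<lambda>(i, e). Z ^ (t * i) * (X ^ e * Y ^ (E - e)))"
  have "\<exists>h. ((\<lambda>f. V * pderiv f) ^^ m) (F q) = F q * h \<and> degree h \<le> 2 * m" for m q
  proof -
    obtain i e where q: "q = (i, e)" by fastforce
    define W where "W = of_nat (t * i) * (X * Y)
      + Z * (of_nat e * Y * pderiv X + of_nat (E - e) * X * pderiv Y)"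
    have Zd: "Z * pderiv (Z ^ n) = of_nat n * Z ^ n" for n
      using pderiv_two_powers[of Z 1 n 0] by (simp add: Z_def pderiv_pCons)
    have "V * pderiv (F q) = Z * pderiv (Z ^ (t * i)) * (X * Y * (X ^ e * Y ^ (E - e)))
       + Z * Z ^ (t * i) * (X * Y * pderiv (X ^ e * Y ^ (E - e)))"
      unfolding q F_def V_def by (simp add: pderiv_mult ring_distribs mult_ac)
    also have "\<dots> = W * F q"
      unfolding Zd pderiv_two_powers unfolding q F_def W_def by (simp add: ring_distribs mult_ac)
    finally have "V * pderiv (F q) = W * F q" .
    moreover have "degree V \<le> 3"
      unfolding V_def X_def Y_def Z_def by (simp add: degree_pCons_le degree_pCons_eq_if)
    moreover have "degree W \<le> 2"
      unfolding W_def X_def Y_def Z_def of_nat_poly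
      by (simp add: pderiv_pCons degree_pCons_eq_if)
    ultimately show ?thesis by (rule iterated_derivation_eigen)
  qed
  then obtain h where h: "\<And>m q. ((\<lambda>f. V * pderiv f) ^^ m) (F q) = F q * h m q"
    "\<And>m q. degree (h m q) \<le> 2 * m" by metis

  \<comment> \<open>At points of \<open>S\<close>, replacing \<open>s ^ t\<close> by 1 and
    \<open>(c - s) ^ t\<close> by \<open>(d * s - 1) ^ t\<close> turns \<open>F q * h m q\<close>
    into \<open>G m q\<close> times a factor common to all \<open>q\<close>. The degree of
    \<open>G m q\<close> no longer grows with \<open>t\<close>, so few conditions suffice.\<close>
  define G where "G m q = X ^ (snd q mod t) * Y ^ (A - 1 - snd q mod t) * h m q" for m q
  define IJ where "IJ = {..<B} \<times> I"
  have deg_G: "degree (G m q) < A + 2 * m" if "q \<in> IJ" for m q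
  proof -
    have "degree (X ^ n) \<le> n" "degree (Y ^ n) \<le> n" for n
      using degree_power_le[of X n] degree_power_le[of Y n]
      by (simp_all add: X_def Y_def degree_pCons_eq_if split: if_splits)
    then have "degree (G m q) \<le> (snd q mod t + (A - 1 - snd q mod t)) + 2 * m"
      unfolding G_def using h(2) by (meson add_mono degree_mult_le le_trans)
    also have "snd q mod t + (A - 1 - snd q mod t) = A - 1"
      using e_split(1)[of "snd q"] that by (auto simp: IJ_def)
    finally show ?thesis using A by simp
  qed
  \<comment> \<open>The index \<open>(m, k)\<close> stands for the vanishing of coefficient
    \<open>k\<close> in the combination of the \<open>G m q\<close>.\<close>
  define J where "J = Sigma {..<A} (\<lambda>m. {..<A + 2 * m})"
  have "card J + A = 2 * A * A"
    using sum_arithmetic_bound[of A A] by (simp add: J_def power2_eq_square)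
  moreover have "card IJ = A * (B * B)"
    using card_I fin_I by (simp add: IJ_def card_cartesian_product)
  moreover have "B * B = 2 * A" by (simp add: A_def B_def power2_eq_square)
  ultimately have "card J < card IJ" using A by (simp add: mult_ac)
  moreover have "finite J" "finite IJ" using fin_I by (auto simp: J_def IJ_def)
  ultimately obtain l where l: "\<exists>q\<in>IJ. l q \<noteq> 0"
    "\<And>m k. (m, k) \<in> J \<Longrightarrow> (\<Sum>q\<in>IJ. l q * coeff (G m q) k) = 0"
    using exists_nontrivial_solution[of J IJ "\<lambda>q (m, k). coeff (G m q) k"] by force
  have G_sum: "(\<Sum>q\<in>IJ. smult (l q) (G m q)) = 0" if "m < A" for m
  proof (rule poly_eqI)
    fix k
    show "coeff (\<Sum>q\<in>IJ. smult (l q) (G m q)) k = coeff 0 k"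
    proof (cases "k < A + 2 * m")
      case True
      then show ?thesis using l(2)[of m k] that by (simp add: coeff_sum J_def)
    next
      case False
      then have "coeff (G m q) k = 0" if "q \<in> IJ" for q
        using deg_G[OF that, of m] by (intro coeff_eq_0) linarith
      then show ?thesis by (simp add: coeff_sum)
    qed
  qed

  define \<Phi> where "\<Phi> = (\<Sum>q\<in>IJ. smult (l q) (F q))"
  have "\<Phi> \<noteq> 0"
  proof
    assume "\<Phi> = 0"
    then have "(\<Sum>(i, e)\<in>{..<B} \<times> {e. e mod t < A \<and> e div t < B}.
      smult (l (i, e)) ([:0, 1:] ^ (t * i) * ([:c, -1:] ^ e * [:-1, d:] ^ (E - e)))) = 0"
      unfolding \<Phi>_def F_def IJ_def I_def X_def Y_def Z_def by (simp add: case_prod_unfold)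
    from stepanov_nonzero[OF c cd E A AB _ this] have "l q = 0" if "q \<in> IJ" for q
      using that e_split(4) unfolding IJ_def I_def by (cases q) auto
    with l(1) show False by blast
  qed
  moreover have "[:-s, 1:] ^ A dvd \<Phi>" if "s \<in> S" for s
  proof (rule linear_power_dvdI[of A V])
    show "A \<le> CHAR('a)" using AE E by linarith
    have s: "s ^ t = 1" "(c - s) ^ t = (d * s - 1) ^ t" "s \<noteq> c" using that by (auto simp: S_def)
    then have "(d * s - 1) ^ t \<noteq> 0" by (metis power_not_zero right_minus_eq)
    then have "d * s - 1 \<noteq> 0" using t by (auto simp: power_0_left)
    moreover have "s \<noteq> 0" using s(1) t by (auto simp: power_0_left)
    moreover have "poly V s = s * ((c - s) * (d * s - 1))"
      by (simp add: V_def X_def Y_def Z_def algebra_simps)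
    ultimately show "poly V s \<noteq> 0" using s(3) by simp
    fix m assume m: "m < A"
    have "poly (F q * h m q) s = poly (G m q) s * (d * s - 1) ^ (t * (B - 1))"
      if "q \<in> IJ" for q
    proof -
      obtain i e where q: "q = (i, e)" by fastforce
      then have e: "e \<in> I" using that by (simp add: IJ_def)
      define a j where "a = e mod t" and "j = e div t"
      have aj: "a \<le> A - 1" "j \<le> B - 1" "e = a + t * j" "e \<le> E"
        unfolding a_def j_def using e_split[OF e] by auto
      \<comment> \<open>The total exponent of \<open>d * s - 1\<close> is \<open>E - a\<close> for
        every \<open>j\<close>; this is what makes the split-off factor common.\<close>
      then have "t * j + (E - e) = (A - 1 - a) + t * (B - 1)"
        unfolding E_def by linarith
      then have *: "(d * s - 1) ^ (t * j) * (d * s - 1) ^ (E - e) =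
          (d * s - 1) ^ (A - 1 - a) * (d * s - 1) ^ (t * (B - 1))"
        by (metis power_add)
      have "poly (F q) s = (s ^ t) ^ i * ((c - s) ^ e * (d * s - 1) ^ (E - e))"
        by (simp add: q F_def X_def Y_def Z_def mult.commute flip: power_mult)
      also have "(c - s) ^ e = (c - s) ^ a * (d * s - 1) ^ (t * j)"
        unfolding aj(3) power_add power_mult s(2) ..
      finally have "poly (F q) s =
          (c - s) ^ a * ((d * s - 1) ^ (t * j) * (d * s - 1) ^ (E - e))"
        by (simp add: s(1) mult.assoc)
      then show ?thesis
        unfolding * G_def by (simp add: q a_def X_def Y_def mult_ac)
    qed
    then have "poly (((\<lambda>f. V * pderiv f) ^^ m) \<Phi>) s =
        poly (\<Sum>q\<in>IJ. smult (l q) (G m q)) s * (d * s - 1) ^ (t * (B - 1))"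
      unfolding \<Phi>_def iterated_derivation_sum h(1) poly_sum sum_distrib_right
      by (intro sum.cong) (simp_all del: poly_mult)
    then show "poly (((\<lambda>f. V * pderiv f) ^^ m) \<Phi>) s = 0" using G_sum[OF m] by simp
  qed
  ultimately have "A * card S \<le> degree \<Phi>" using A by (intro card_mult_le_degree)
  also have "\<dots> \<le> t * (B - 1) + E"
    unfolding \<Phi>_def
  proof (rule degree_sum_le)
    show "finite IJ" by fact
    fix q assume "q \<in> IJ"
    then obtain i e where q: "q = (i, e)" "i \<le> B - 1" "e \<in> I" by (auto simp: IJ_def)
    have "degree (X ^ n) \<le> n" "degree (Y ^ n) \<le> n" "degree (Z ^ n) \<le> n" for n
      using degree_power_le[of X n] degree_power_le[of Y n] degree_power_le[of Z n]
      by (simp_all add: X_def Y_def Z_def degree_pCons_eq_if split: if_splits)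
    then have "degree (F q) \<le> t * i + (e + (E - e))"
      unfolding F_def q(1) case_prod_conv by (meson add_mono degree_mult_le le_trans)
    also have "\<dots> \<le> t * (B - 1) + E" using q e_split(4) by (intro add_mono) auto
    finally show "degree (smult (l q) (F q)) \<le> t * (B - 1) + E"
      by (meson degree_smult_le le_trans)
  qed
  also have "\<dots> \<le> 2 * (t * B)" using EB \<open>t * B = t * (B - 1) + t\<close> by linarith
  finally have "2 * b * (b * card S) \<le> 2 * b * (2 * t)"
    by (simp add: A_def B_def power2_eq_square mult_ac)
  then show ?thesis using b unfolding S_def by (subst (asm) mult_le_cancel1) auto
qed

section \<open>Triples of roots of unity\<close>

lemma card_power_eq_1:
  assumes "t > 0"
  shows "finite {x::'a::field. x ^ t = 1}" "card {x::'a. x ^ t = 1} \<le> t"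
proof -
  define f :: "'a poly" where "f = monom 1 t - 1"
  have "coeff f t = 1" using assms by (simp add: f_def)
  then have "f \<noteq> 0" by auto
  have roots: "{x. poly f x = 0} = {x. x ^ t = 1}" by (simp add: f_def poly_monom)
  have "degree f \<le> t" unfolding f_def by (intro degree_diff_le) (auto intro: degree_monom_le)
  with poly_roots_finite[OF \<open>f \<noteq> 0\<close>] card_poly_roots_bound[OF \<open>f \<noteq> 0\<close>] roots
  show "finite {x::'a. x ^ t = 1}" "card {x::'a. x ^ t = 1} \<le> t" by simp_all
qed

text \<open>\<open>b\<close> is taken as large as \<open>stepanov_bound\<close> allows, up to
  constants. Its two constraints give the two entries of the minimum \<open>x\<close>, and
  \<open>1 / x\<close> is at most the sum of their reciprocals, whence the two terms of the
  bound.\<close>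

lemma stepanov_card:
  fixes c d :: "'a::field"
  assumes c: "c \<noteq> 0" and cd: "c * d \<noteq> 1" and t: "t > 0" and p: "CHAR('a) > 0"
  shows "real (card {s::'a. s ^ t = 1 \<and> (c - s) ^ t = (d * s - 1) ^ t \<and> s \<noteq> c})
    \<le> 8 * (real t powr (2 / 3) + real t ^ 2 / real CHAR('a))"
proof -
  define S where "S = {s::'a. s ^ t = 1 \<and> (c - s) ^ t = (d * s - 1) ^ t \<and> s \<noteq> c}"
  define x where "x = min (real t powr (1 / 3) / 2) (real CHAR('a) / (2 * real t))"
  have x0: "x > 0" using t p by (simp add: x_def)
  have "x * real (card S) \<le> 4 * real t"
  proof (cases "x < 1")
    \<comment> \<open>No positive integer \<open>b\<close> lies below \<open>x\<close>; the trivial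
      bound \<open>card S \<le> t\<close> suffices.\<close>
    case True
    have "card S \<le> card {s::'a. s ^ t = 1}"
      using card_power_eq_1(1)[OF t] by (intro card_mono) (auto simp: S_def)
    then have "real (card S) \<le> real t" using card_power_eq_1(2)[OF t, where 'a = 'a] by simp
    then have "x * real (card S) \<le> 1 * real t" using True x0 by (intro mult_mono) auto
    then show ?thesis by simp
  next
    case False
    define b where "b = nat \<lfloor>x\<rfloor>"
    have b: "real b \<le> x" "x < real b + 1" "b > 0" using False by (simp_all add: b_def)
    have "real b ^ 3 \<le> (real t powr (1 / 3) / 2) ^ 3"
      using b(1) by (intro power_mono) (auto simp: x_def)
    also have "\<dots> = (real t powr (1 / 3)) powr 3 / 8"
      using t by (simp add: power_divide powr_numeral)
    also have "\<dots> = real t / 8" by (simp add: powr_powr)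
    finally have "real (8 * b ^ 3) \<le> real t" by simp
    then have bt: "4 * b ^ 3 \<le> t" by linarith
    have "real b \<le> real CHAR('a) / (2 * real t)" using b(1) by (simp add: x_def)
    then have "real (2 * b * t) \<le> real CHAR('a)" using t by (simp add: field_simps)
    then have "2 * b * t \<le> CHAR('a)" by linarith
    with bt have "b * card S \<le> 2 * t"
      unfolding S_def by (intro stepanov_bound[OF c cd b(3)])
    then have "real (b * card S) \<le> real (2 * t)" by (simp only: of_nat_le_iff)
    then have "real b * real (card S) \<le> 2 * real t" by simp
    moreover have "x \<le> 2 * real b" using b by linarith
    then have "x * real (card S) \<le> 2 * real b * real (card S)" by (intro mult_right_mono) auto
    ultimately show ?thesis by simp
  qed
  then have le: "real (card S) \<le> 4 * real t * (1 / x)" using x0 by (simp add: pos_le_divide_eq mult.commute)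
  have "1 / x \<le> 2 * real t powr (- 1 / 3) + 2 * real t / real CHAR('a)"
  proof (cases "real t powr (1 / 3) / 2 \<le> real CHAR('a) / (2 * real t)")
    case True
    then have x: "x = real t powr (1 / 3) / 2" unfolding x_def by (rule min_absorb1)
    have "1 / x = 2 * inverse (real t powr (1 / 3))"
      unfolding x
      by (simp only: divide_inverse inverse_mult_distrib inverse_inverse_eq mult_ac mult_1_right)
    also have "inverse (real t powr (1 / 3)) = real t powr (- 1 / 3)"
      unfolding powr_minus[symmetric] by simp
    finally show ?thesis by simp
  next
    case False
    then have "x = real CHAR('a) / (2 * real t)" unfolding x_def by (intro min_absorb2) simp
    then have "1 / x = 2 * real t / real CHAR('a)" by simp
    then show ?thesis by simp
  qed
  then have "4 * real t * (1 / x) \<le>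
      4 * real t * (2 * real t powr (- 1 / 3) + 2 * real t / real CHAR('a))"
    by (rule mult_left_mono) simp
  also have "\<dots> =
     8 * (real t powr 1 * real t powr (- 1 / 3) + real t ^ 2 / real CHAR('a))"
    using t by (simp add: algebra_simps power2_eq_square)
  also have "real t powr 1 * real t powr (- 1 / 3) = real t powr (2 / 3)"
    unfolding powr_add[symmetric] by simp
  finally show ?thesis using le unfolding S_def by linarith
qed

text \<open>Clearing denominators gives \<open>x * y * b = a\<close>, so \<open>b\<close> is nonzero
  and the product \<open>x * y\<close> is fixed. The sum being fixed too, \<open>x\<close> and
  \<open>y\<close> are the roots of one quadratic polynomial.\<close>

lemma sum_and_inverse_sum_determine_pair:
  fixes a b :: "'a::field"
  assumes "a \<noteq> 0"
  defines "P \<equiv> {(x, y). x \<noteq> 0 \<and> y \<noteq> 0 \<and> x + y = a \<and> inverse x + inverse y = b}"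
  shows "finite P" "card P \<le> 2"
proof -
  have "\<exists>x0 y0. P \<subseteq> {(x0, y0), (y0, x0)}"
  proof (cases "P = {}")
    case False
    have prod: "x * y * b = a" if "(x, y) \<in> P" for x y
    proof -
      have *: "x \<noteq> 0" "y \<noteq> 0" "x + y = a" "inverse x + inverse y = b"
        using that by (auto simp: P_def)
      have "x * y * b = (x * inverse x) * y + (y * inverse y) * x"
        unfolding *(4)[symmetric] by (simp only: ring_distribs mult_ac)
      then show ?thesis using * by (simp add: add.commute)
    qed
    from False obtain x0 y0 where 0: "(x0, y0) \<in> P" by fast
    have "b \<noteq> 0" using prod[OF 0] assms(1) by auto
    have "(x, y) = (x0, y0) \<or> (x, y) = (y0, x0)" if "(x, y) \<in> P" for x y
    proof -
      have p: "x * y = x0 * y0"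
        using prod[OF that] prod[OF 0] mult_right_cancel[OF \<open>b \<noteq> 0\<close>, of "x * y" "x0 * y0"] by simp
      have s: "x + y = x0 + y0" using that 0 by (simp add: P_def)
      have "(x - x0) * (x - y0) = x * x - x * (x0 + y0) + x0 * y0"
        by (simp add: algebra_simps)
      then have "(x - x0) * (x - y0) = x * x - x * (x + y) + x * y" by (simp only: p s)
      then have "(x - x0) * (x - y0) = 0" by (simp add: algebra_simps)
      then have "x = x0 \<or> x = y0" by simp
      then show ?thesis
      proof
        assume "x = x0"
        then show ?thesis using s by simp
      next
        assume "x = y0"
        then show ?thesis using s by (simp add: add.commute)
      qed
    qed
    then have "P \<subseteq> {(x0, y0), (y0, x0)}" by fast
    then show ?thesis by blast
  qed auto
  then obtain x0 y0 where sub: "P \<subseteq> {(x0, y0), (y0, x0)}" by blast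
  show "finite P" using sub by (rule finite_subset) auto
  have "card P \<le> card {(x0, y0), (y0, x0)}" using sub by (intro card_mono) auto
  also have "\<dots> \<le> 2" using card_insert_le_m1[of 2 "{(y0, x0)}" "(x0, y0)"] by simp
  finally show "card P \<le> 2" .
qed

section \<open>Fibres of the map from triples to sums and sums of inverses\<close>

definition unity_triples :: "nat \<Rightarrow> ('a::field \<times> 'a \<times> 'a) set" where
  "unity_triples t = {(x, y, z). x ^ t = 1 \<and> y ^ t = 1 \<and> z ^ t = 1}"

definition unity_fiber :: "nat \<Rightarrow> 'a::field \<Rightarrow> 'a \<Rightarrow> ('a \<times> 'a \<times> 'a) set" where
  "unity_fiber t c d = {(x, y, z) \<in> unity_triples t.
     x + y + z = c \<and> inverse x + inverse y + inverse z = d}"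

lemma card_unity_triples:
  assumes "t > 0"
  shows "finite (unity_triples t :: ('a::field \<times> 'a \<times> 'a) set)"
    "card (unity_triples t :: ('a \<times> 'a \<times> 'a) set) \<le> t ^ 3"
proof -
  define G where "G = {x::'a. x ^ t = 1}"
  have G: "finite G" "card G \<le> t" unfolding G_def using card_power_eq_1[OF assms] by auto
  have *: "unity_triples t = G \<times> G \<times> G" by (auto simp: unity_triples_def G_def)
  show "finite (unity_triples t :: ('a \<times> 'a \<times> 'a) set)" using G * by simp
  have "card G * (card G * card G) \<le> t * (t * t)" using G by (intro mult_le_mono)
  then show "card (unity_triples t :: ('a \<times> 'a \<times> 'a) set) \<le> t ^ 3"
    by (simp add: * card_cartesian_product power3_eq_cube mult.assoc)
qed

lemma unity_nonzero: "t > 0 \<Longrightarrow> x ^ t = 1 \<Longrightarrow> x \<noteq> (0 :: 'a::field)"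
  by (auto simp: power_0_left)

text \<open>For fixed \<open>z\<close> the remaining sum \<open>c - z\<close> is nonzero, so at most
  two pairs \<open>(x, y)\<close> complete the triple.\<close>

lemma card_unity_fiber_section:
  fixes c d :: "'a::field"
  assumes t: "t > 0" and Zs: "finite Zs" "c \<notin> Zs"
  shows "card {(x, y, z) \<in> unity_fiber t c d. z \<in> Zs} \<le> 2 * card Zs"
proof -
  define P where "P z = {(x, y). x \<noteq> 0 \<and> y \<noteq> 0 \<and> x + y = c - z \<and>
    inverse x + inverse y = d - inverse z}" for z
  have P: "finite (P z)" "card (P z) \<le> 2" if "z \<in> Zs" for z
    using sum_and_inverse_sum_determine_pair[of "c - z" "d - inverse z"] that Zs(2)
    unfolding P_def by auto
  have "{(x, y, z) \<in> unity_fiber t c d. z \<in> Zs} \<subseteq> (\<Union>z\<in>Zs. (\<lambda>(x, y). (x, y, z)) ` P z)"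
    using unity_nonzero[OF t] by (force simp: unity_fiber_def unity_triples_def P_def algebra_simps)
  then have "card {(x, y, z) \<in> unity_fiber t c d. z \<in> Zs} \<le>
      card (\<Union>z\<in>Zs. (\<lambda>(x, y). (x, y, z)) ` P z)"
    using P Zs by (intro card_mono) auto
  also have "\<dots> \<le> (\<Sum>z\<in>Zs. card ((\<lambda>(x, y). (x, y, z)) ` P z))"
    using Zs by (intro card_UN_le)
  also have "\<dots> \<le> (\<Sum>z\<in>Zs. 2)" by (intro sum_mono le_trans[OF card_image_le P(2)] P(1))
  finally show ?thesis by simp
qed

text \<open>This serves the degenerate \<open>c\<close>, \<open>d\<close>. Triples with
  \<open>z = c\<close> have the form \<open>(x, - x, c)\<close>, at most \<open>t\<close> of them;
  the others number at most \<open>2 * t\<close>.\<close>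

lemma card_unity_fiber_le:
  fixes c d :: "'a::field"
  assumes t: "t > 0"
  shows "card (unity_fiber t c d) \<le> 3 * t"
proof -
  define G where "G = {x::'a. x ^ t = 1}"
  have G: "finite G" "card G \<le> t" unfolding G_def using card_power_eq_1[OF assms] by auto
  have "unity_fiber t c d \<subseteq>
      {(x, y, z) \<in> unity_fiber t c d. z \<in> G - {c}} \<union> (\<lambda>x. (x, - x, c)) ` G"
    by (auto simp: unity_fiber_def unity_triples_def G_def image_iff eq_neg_iff_add_eq_0 add.commute)
  moreover have "finite (unity_fiber t c d)"
    using card_unity_triples(1)[OF t] by (rule rev_finite_subset) (auto simp: unity_fiber_def)
  then have "finite {(x, y, z) \<in> unity_fiber t c d. z \<in> G - {c}}"
    by (rule rev_finite_subset) auto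
  ultimately have "card (unity_fiber t c d) \<le>
      card {(x, y, z) \<in> unity_fiber t c d. z \<in> G - {c}} + card ((\<lambda>x. (x, - x, c)) ` G)"
    using G by (meson card_Un_le card_mono finite_UnI finite_imageI le_trans)
  also have "card ((\<lambda>x. (x, - x, c)) ` G) \<le> t" using G card_image_le le_trans by blast
  also have "card {(x, y, z) \<in> unity_fiber t c d. z \<in> G - {c}} \<le> 2 * card (G - {c})"
    using G by (intro card_unity_fiber_section[OF t]) auto
  also have "card (G - {c}) \<le> t" using G by (meson card_Diff1_le le_trans)
  finally show ?thesis by simp
qed

text \<open>
  Eliminating \<open>x\<close> and \<open>y\<close> from \<open>x + y = c - z\<close> and \<open>1/x + 1/y = d - 1/z\<close> leaves
  \<open>x y (d z - 1) = z (c - z)\<close>, whose \<open>t\<close>-th power no longer involves \<open>x\<close> and \<open>y\<close>.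
\<close>

lemma card_unity_fiber_generic:
  fixes c d :: "'a::field"
  assumes t: "t > 0" and p: "CHAR('a) > 0" and c: "c \<noteq> 0" and cd: "c * d \<noteq> 1"
  shows "real (card (unity_fiber t c d)) \<le>
    16 * (real t powr (2 / 3) + real t ^ 2 / real CHAR('a))"
proof -
  define S where "S = {s::'a. s ^ t = 1 \<and> (c - s) ^ t = (d * s - 1) ^ t \<and> s \<noteq> c}"
  have "z \<in> S" if "(x, y, z) \<in> unity_fiber t c d" for x y z
  proof -
    have 1: "x ^ t = 1" "y ^ t = 1" "z ^ t = 1" "x + y = c - z"
      "inverse x + inverse y = d - inverse z"
      using that by (auto simp: unity_fiber_def unity_triples_def algebra_simps)
    then have nz: "x \<noteq> 0" "y \<noteq> 0" "z \<noteq> 0" using unity_nonzero[OF t] by auto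
    \<comment> \<open>Were \<open>z = c\<close>, then \<open>x\<close> and \<open>y\<close> would
      cancel in both sums, leaving \<open>d = inverse c\<close>.\<close>
    have "z \<noteq> c"
    proof
      assume "z = c"
      then have "y = - x" using 1(4) by (simp add: eq_neg_iff_add_eq_0 add.commute)
      then have "d = inverse c" using 1(5) \<open>z = c\<close> by simp
      then show False using c cd by simp
    qed
    moreover have "x * y * (d * z - 1) = z * (c - z)"
      using 1(5) nz unfolding 1(4)[symmetric] by (simp add: field_simps)
    then have "(x * y * (d * z - 1)) ^ t = (z * (c - z)) ^ t" by simp
    then have "(c - z) ^ t = (d * z - 1) ^ t" using 1 by (simp add: power_mult_distrib)
    ultimately show ?thesis using 1 by (simp add: S_def)
  qed
  then have "unity_fiber t c d = {(x, y, z) \<in> unity_fiber t c d. z \<in> S}" by auto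
  moreover have "finite S" "c \<notin> S"
    using card_power_eq_1(1)[OF t, where 'a = 'a] by (auto simp: S_def)
  ultimately have "card (unity_fiber t c d) \<le> 2 * card S"
    using card_unity_fiber_section[OF t, of S c d] by simp
  then show ?thesis using stepanov_card[OF c cd t p] unfolding S_def by linarith
qed

text \<open>When the sum is nonzero, the second condition clears to
  \<open>(x + y) * (y + z) * (z + x) = 0\<close>. Degenerate triples thus lie in four planes, and in
  each plane two coordinates determine the third.\<close>

lemma card_degenerate_triples:
  assumes t: "t > 0"
  shows "card {(x, y, z) \<in> unity_triples t :: ('a::field \<times> 'a \<times> 'a) set.
     x + y + z = 0 \<or> (x + y + z) * (inverse x + inverse y + inverse z) = 1} \<le> 4 * t ^ 2"
    (is "card ?B \<le> _")
proof -
  define G where "G = {x::'a. x ^ t = 1}"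
  have G: "finite G" "card G \<le> t" unfolding G_def using card_power_eq_1[OF assms] by auto
  define H where "H = G \<times> G"
  have H: "finite H" "card H \<le> t ^ 2"
    using G by (auto simp: H_def card_cartesian_product power2_eq_square intro: mult_le_mono)
  define f :: "nat \<Rightarrow> 'a \<times> 'a \<Rightarrow> 'a \<times> 'a \<times> 'a" where
    "f i = (\<lambda>(x, y). if i = 0 then (x, y, - x - y) else if i = 1 then (x, - x, y)
       else if i = 2 then (x, y, - y) else (x, y, - x))" for i
  have "?B \<subseteq> (\<Union>i<4. f i ` H)"
  proof clarify
    fix x y z :: 'a
    assume T: "(x, y, z) \<in> unity_triples t"
      and *: "x + y + z = 0 \<or> (x + y + z) * (inverse x + inverse y + inverse z) = 1"
    have nz: "x \<noteq> 0" "y \<noteq> 0" "z \<noteq> 0"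
      using T unity_nonzero[OF t] by (auto simp: unity_triples_def)
    have H': "(x, y) \<in> H" "(x, z) \<in> H" using T by (auto simp: unity_triples_def H_def G_def)
    have "(x + y) * (y + z) * (z + x) = 0" if "x + y + z \<noteq> 0"
    proof -
      have "(x + y + z) * (y * z + x * z + x * y) = x * y * z"
        using * that nz by (auto simp: field_simps)
      moreover have "(x + y) * (y + z) * (z + x) =
          (x + y + z) * (y * z + x * z + x * y) - x * y * z" by (simp add: algebra_simps)
      ultimately show ?thesis by simp
    qed
    then have "x + y + z = 0 \<or> x + y = 0 \<or> y + z = 0 \<or> z + x = 0" by fastforce
    then have "z = - x - y \<or> y = - x \<or> z = - y \<or> z = - x"
      by (auto simp: eq_neg_iff_add_eq_0 algebra_simps)
    then have "(x, y, z) = f 0 (x, y) \<or> (x, y, z) = f 1 (x, z) \<or> (x, y, z) = f 2 (x, y) \<or>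
        (x, y, z) = f 3 (x, y)"
      by (auto simp: f_def)
    then show "(x, y, z) \<in> (\<Union>i<4. f i ` H)"
    proof (elim disjE)
      assume "(x, y, z) = f 0 (x, y)" then show ?thesis using H' by (intro UN_I[of 0]) auto
    next
      assume "(x, y, z) = f 1 (x, z)" then show ?thesis using H' by (intro UN_I[of 1]) auto
    next
      assume "(x, y, z) = f 2 (x, y)" then show ?thesis using H' by (intro UN_I[of 2]) auto
    next
      assume "(x, y, z) = f 3 (x, y)" then show ?thesis using H' by (intro UN_I[of 3]) auto
    qed
  qed
  then have "card ?B \<le> card (\<Union>i<4. f i ` H)" using H by (intro card_mono) auto
  also have "\<dots> \<le> (\<Sum>i<4. card (f i ` H))" by (intro card_UN_le) auto
  also have "\<dots> \<le> (\<Sum>i<(4::nat). t ^ 2)"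
    by (intro sum_mono le_trans[OF card_image_le H(2)] H(1))
  finally show ?thesis by simp
qed

definition unity_pairs :: "nat \<Rightarrow> (('a::field \<times> 'a \<times> 'a) \<times> ('a \<times> 'a \<times> 'a)) set" where
  "unity_pairs t = {((x, y, z), (u, v, w)).
     (x, y, z) \<in> unity_triples t \<and> (u, v, w) \<in> unity_triples t \<and>
     x + y + z = u + v + w \<and>
     inverse x + inverse y + inverse z = inverse u + inverse v + inverse w}"

text \<open>The second triple lies in the fibre determined by the first. At most
  \<open>4 * t ^ 2\<close> first triples are degenerate, with fibres of size at most
  \<open>3 * t\<close>; the others have the generic bound. Hence the constant 28 = 12 + 16.\<close>

lemma card_unity_pairs:
  assumes t: "t > 0" and p: "CHAR('a::field) > 0"
  shows "finite (unity_pairs t :: (('a \<times> 'a \<times> 'a) \<times> ('a \<times> 'a \<times> 'a)) set)"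
    "real (card (unity_pairs t :: (('a \<times> 'a \<times> 'a) \<times> ('a \<times> 'a \<times> 'a)) set)) \<le>
       28 * (real t powr (11 / 3) + real t ^ 5 / real CHAR('a))"
proof -
  define T where "T = (unity_triples t :: ('a \<times> 'a \<times> 'a) set)"
  define c d where "c = (\<lambda>(x::'a, y, z). x + y + z)"
    and "d = (\<lambda>(x::'a, y, z). inverse x + inverse y + inverse z)"
  define B where "B = {q \<in> T. c q = 0 \<or> c q * d q = 1}"
  define M where "M = 16 * (real t powr (2 / 3) + real t ^ 2 / real CHAR('a))"
  have T: "finite T" "card T \<le> t ^ 3" unfolding T_def using card_unity_triples[OF t] by auto
  have fin: "finite (unity_fiber t c' d')" for c' d' :: 'a
    using T(1) unfolding T_def by (rule rev_finite_subset) (auto simp: unity_fiber_def)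
  have eq: "unity_pairs t = Sigma T (\<lambda>q. unity_fiber t (c q) (d q))"
    by (auto simp: unity_pairs_def unity_fiber_def T_def c_def d_def)
  show "finite (unity_pairs t :: (('a \<times> 'a \<times> 'a) \<times> ('a \<times> 'a \<times> 'a)) set)"
    unfolding eq using T fin by auto
  have "B = {(x, y, z) \<in> unity_triples t.
     x + y + z = 0 \<or> (x + y + z) * (inverse x + inverse y + inverse z) = 1}"
    by (auto simp: B_def T_def c_def d_def)
  then have B: "card B \<le> 4 * t ^ 2" using card_degenerate_triples[OF t, where 'a = 'a] by simp
  have "M \<ge> 0" by (simp add: M_def)
  have "real (card (unity_pairs t :: (('a \<times> 'a \<times> 'a) \<times> ('a \<times> 'a \<times> 'a)) set)) =
      (\<Sum>q\<in>T. real (card (unity_fiber t (c q) (d q))))"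
    unfolding eq using T fin by (simp add: card_SigmaI)
  also have "\<dots> \<le> (\<Sum>q\<in>T. (if q \<in> B then 3 * real t else 0) + M)"
  proof (rule sum_mono)
    fix q assume "q \<in> T"
    have "real (card (unity_fiber t (c q) (d q))) \<le> 3 * real t"
      using card_unity_fiber_le[OF t, of "c q" "d q"] by linarith
    moreover have "real (card (unity_fiber t (c q) (d q))) \<le> M" if "q \<notin> B"
      unfolding M_def using that \<open>q \<in> T\<close> by (intro card_unity_fiber_generic[OF t p]) (auto simp: B_def)
    ultimately show "real (card (unity_fiber t (c q) (d q))) \<le> (if q \<in> B then 3 * real t else 0) + M"
      using \<open>M \<ge> 0\<close> by auto
  qed
  also have "\<dots> = real (card B) * (3 * real t) + real (card T) * M"
    using T by (simp add: sum.distrib sum.If_cases B_def Int_def conj_commute)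
  also have "\<dots> \<le> real (4 * t ^ 2) * (3 * real t) + real (t ^ 3) * M"
    using B T \<open>M \<ge> 0\<close>
    by (intro add_mono mult_right_mono) (auto simp flip: of_nat_power simp del: of_nat_power)
  also have "\<dots> = 12 * real t ^ 3 + 16 * (real t ^ 3 * real t powr (2 / 3)) +
      16 * (real t ^ 5 / real CHAR('a))"
    by (simp add: M_def algebra_simps eval_nat_numeral)
  also have "\<dots> \<le> 28 * (real t powr (11 / 3) + real t ^ 5 / real CHAR('a))"
  proof -
    have cube: "real t ^ 3 = real t powr 3" using t by (simp add: powr_numeral)
    have "real t ^ 3 * real t powr (2 / 3) = real t powr (11 / 3)"
      unfolding cube powr_add[symmetric] by simp
    moreover have "real t ^ 3 \<le> real t powr (11 / 3)"
      unfolding cube using t by (intro powr_mono) auto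
    moreover have "real t ^ 5 / real CHAR('a) \<ge> 0" by simp
    ultimately show ?thesis unfolding ring_distribs by linarith
  qed
  finally show "real (card (unity_pairs t :: (('a \<times> 'a \<times> 'a) \<times> ('a \<times> 'a \<times> 'a)) set)) \<le>
       28 * (real t powr (11 / 3) + real t ^ 5 / real CHAR('a))" .
qed

section \<open>Eigenvectors of matrices modulo \<open>p\<close>\<close>

text \<open>Integer residues act on the field through \<open>of_int\<close>, compatibly with
  reduction modulo \<open>p\<close> in characteristic \<open>p\<close>. That the vector is nonzero
  is imposed where it matters.\<close>

fun eigenpair :: "int mat2 \<Rightarrow> 'a::field \<times> 'a \<Rightarrow> 'a \<Rightarrow> bool" where
  "eigenpair (Mat2 a b c d) (x, y) l \<longleftrightarrow>
     of_int a * x + of_int b * y = l * x \<and> of_int c * x + of_int d * y = l * y"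

lemma of_int_mod_CHAR:
  assumes "CHAR('a::field) = p"
  shows "of_int (k mod int p) = (of_int k :: 'a)"
proof -
  have "(of_int k :: 'a) = of_int (k mod int p + int p * (k div int p))" by simp
  also have "\<dots> = of_int (k mod int p)"
    unfolding of_int_add of_int_mult using assms of_nat_CHAR[where 'a = 'a] by simp
  finally show ?thesis ..
qed

lemma of_int_inj_CHAR:
  assumes "CHAR('a::field) = p" "i \<in> {0..int p - 1}" "j \<in> {0..int p - 1}"
    and "of_int i = (of_int j :: 'a)"
  shows "i = j"
proof -
  have "of_nat (nat i) = (of_nat (nat j) :: 'a)" using assms by simp
  then have "nat i = nat j"
    by (subst (asm) of_nat_eq_iff_less_CHAR) (use assms in auto)
  then show ?thesis using assms by (simp add: eq_nat_nat_iff)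
qed

lemma eigenpair_one: "eigenpair (\<one>\<^bsub>mat2_ring (Fp p)\<^esub>) v 1"
  by (cases v) (simp add: mat2_ring_def mat2_diag_def residue_ring_def)

text \<open>For a common eigenvector, passing to eigenvalues respects the ring operations. This
  takes the place of conjugating to diagonal form.\<close>

lemma eigenpair_add:
  assumes "CHAR('a::field) = p" "eigenpair A (v :: 'a \<times> 'a) l" "eigenpair B v k"
  shows "eigenpair (A \<oplus>\<^bsub>mat2_ring (Fp p)\<^esub> B) v (l + k)"
  using assms(2,3)
  by (cases A; cases B; cases v)
     (simp add: mat2_ring_def residue_ring_def of_int_mod_CHAR[OF assms(1)], simp add: algebra_simps)

lemma eigenpair_mult:
  assumes "CHAR('a::field) = p" "eigenpair A (v :: 'a \<times> 'a) l" "eigenpair B v k"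
  shows "eigenpair (A \<otimes>\<^bsub>mat2_ring (Fp p)\<^esub> B) v (l * k)"
proof -
  obtain a b c d where A: "A = Mat2 a b c d" by (cases A)
  obtain a' b' c' d' where B: "B = Mat2 a' b' c' d'" by (cases B)
  obtain x y where v: "v = (x, y)" by (cases v)
  have 1: "of_int a * x + of_int b * y = l * x" "of_int c * x + of_int d * y = l * y"
    "of_int a' * x + of_int b' * y = k * x" "of_int c' * x + of_int d' * y = k * y"
    using assms(2,3) by (simp_all add: A B v)
  have row: "(u * of_int a' + v * of_int c') * x + (u * of_int b' + v * of_int d') * y = l * k * s"
    if "u * x + v * y = l * s" for u v s
  proof -
    have "(u * of_int a' + v * of_int c') * x + (u * of_int b' + v * of_int d') * y =
        u * (of_int a' * x + of_int b' * y) + v * (of_int c' * x + of_int d' * y)"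
      by (simp add: algebra_simps)
    also have "\<dots> = k * (u * x + v * y)" unfolding 1(3,4) by (simp add: algebra_simps)
    finally show ?thesis using that by (simp add: mult_ac)
  qed
  show ?thesis
    using row[OF 1(1)] row[OF 1(2)]
    by (simp add: A B v mat2_ring_def residue_ring_def of_int_mod_CHAR[OF assms(1)])
qed

lemma eigenpair_pow:
  assumes "CHAR('a::field) = p" "eigenpair A (v :: 'a \<times> 'a) l"
  shows "eigenpair (A [^]\<^bsub>mat2_ring (Fp p)\<^esub> (n::nat)) v (l ^ n)"
proof (induction n)
  case 0
  then show ?case using eigenpair_one by simp
next
  case (Suc n)
  then show ?case using eigenpair_mult[OF assms(1) Suc assms(2)]
    by (simp add: nat_pow_def mult.commute)
qed

lemma eigenpair_unique:
  assumes "eigenpair A v l" "eigenpair A v k" "v \<noteq> (0, 0)"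
  shows "l = k"
  using assms by (cases A; cases v) auto

text \<open>The last multiplication reduces all entries modulo \<open>p\<close>, whatever the
  entries of \<open>A\<close>.\<close>

lemma mat2_pow_closed:
  assumes "p > 0" "n > 0"
  shows "A [^]\<^bsub>mat2_ring (Fp p)\<^esub> (n::nat) \<in> carrier (mat2_ring (Fp p))"
proof (cases n)
  case (Suc k)
  obtain a b c d where B: "A [^]\<^bsub>mat2_ring (Fp p)\<^esub> k = Mat2 a b c d"
    by (cases "A [^]\<^bsub>mat2_ring (Fp p)\<^esub> k")
  obtain a' b' c' d' where A: "A = Mat2 a' b' c' d'" by (cases A)
  have "A [^]\<^bsub>mat2_ring (Fp p)\<^esub> n = mat2_mult (Fp p) (Mat2 a b c d) A"
    using B by (simp add: Suc nat_pow_def mat2_ring_def)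
  then show ?thesis using assms(1) by (simp add: A mat2_ring_def residue_ring_def)
qed (use assms(2) in simp)

text \<open>Each row of the difference annihilates two independent vectors, so it is zero in the
  field; residues are recovered from their images.\<close>

lemma eigenpairs_determine_matrix:
  fixes x y z w :: "'a::field"
  assumes p: "CHAR('a) = p"
    and AB: "A \<in> carrier (mat2_ring (Fp p))" "B \<in> carrier (mat2_ring (Fp p))"
    and ind: "x * w - y * z \<noteq> 0"
    and "eigenpair A (x, y) l" "eigenpair A (z, w) m"
    and "eigenpair B (x, y) l" "eigenpair B (z, w) m"
  shows "A = B"
proof -
  obtain a b c d where A: "A = Mat2 a b c d" by (cases A)
  obtain a' b' c' d' where B: "B = Mat2 a' b' c' d'" by (cases B)
  have *: "i = i' \<and> j = j'"
    if "{i, i', j, j'} \<subseteq> {0..int p - 1}" "of_int i * x + of_int j * y = of_int i' * x + of_int j' * y"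
      "of_int i * z + of_int j * w = of_int i' * z + of_int j' * w" for i j i' j'
  proof -
    define e f where "e = (of_int i - of_int i' :: 'a)" and "f = (of_int j - of_int j' :: 'a)"
    have 1: "e * x + f * y = 0" "e * z + f * w = 0"
      using that(2,3) by (simp_all add: e_def f_def algebra_simps)
    have "e * (x * w - y * z) = (e * x + f * y) * w - (e * z + f * w) * y"
      "f * (x * w - y * z) = (e * z + f * w) * x - (e * x + f * y) * z"
      by (simp_all add: algebra_simps)
    then have "e = 0" "f = 0" using ind 1 by simp_all
    then show ?thesis
      using of_int_inj_CHAR[OF p, of i i'] of_int_inj_CHAR[OF p, of j j'] that(1)
      by (simp add: e_def f_def)
  qed
  show ?thesis
    using *[of a a' b b'] *[of c c' d d'] assms(5-8) AB
    by (simp add: A B mat2_ring_def residue_ring_def)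
qed

text \<open>With the eigenvectors as columns of \<open>P\<close>, the determinant of
  \<open>A P\<close> is both \<open>det A * det P\<close> and \<open>l * m * det P\<close>.\<close>

lemma SL2_eigenvalues_inverse:
  fixes x y z w :: "'a::field"
  assumes p: "CHAR('a) = p" "prime p" and A: "A \<in> SL2 (Fp p)"
    and ind: "x * w - y * z \<noteq> 0"
    and "eigenpair A (x, y) l" "eigenpair A (z, w) m"
  shows "l * m = 1"
proof -
  interpret residues "int p" "Fp p" by (rule residues.intro) (use p prime_gt_1_nat[of p] in auto)
  obtain a b c d where A': "A = Mat2 a b c d" by (cases A)
  have "(of_int (mat2_det (Fp p) A) :: 'a) = of_int a * of_int d - of_int b * of_int c"
    by (simp add: A' a_minus_def res_add_eq res_mult_eq res_neg_eq of_int_mod_CHAR[OF p(1)])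
  moreover have "mat2_det (Fp p) A = 1" using A by (simp add: SL2_def res_one_eq)
  ultimately have det: "of_int a * of_int d - of_int b * of_int c = (1 :: 'a)" by simp
  have 1: "of_int a * x + of_int b * y = l * x" "of_int c * x + of_int d * y = l * y"
    "of_int a * z + of_int b * w = m * z" "of_int c * z + of_int d * w = m * w"
    using assms(5,6) by (simp_all add: A')
  have "l * m * (x * w - y * z) = (l * x) * (m * w) - (l * y) * (m * z)"
    by (simp add: algebra_simps)
  also have "\<dots> = (of_int a * of_int d - of_int b * of_int c) * (x * w - y * z)"
    unfolding 1[symmetric] by (simp add: algebra_simps)
  finally show ?thesis using ind det by simp
qed

text \<open>Pigeonhole principle on the powers of \<open>l\<close>.\<close>

lemma finite_field_power_eq_1:
  fixes l :: "'a::field"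
  assumes "finite (UNIV :: 'a set)" "l \<noteq> 0"
  shows "\<exists>n>0. l ^ n = 1"
proof -
  have "\<not> inj (\<lambda>n::nat. l ^ n)"
    using assms(1) by (metis finite_imageD finite_subset infinite_UNIV_nat subset_UNIV)
  then obtain i j :: nat where ij: "i < j" "l ^ i = l ^ j"
    unfolding inj_def by (metis linorder_neqE_nat)
  have "l ^ j = l ^ i * l ^ (j - i)" using ij(1) power_add[of l i "j - i"] by simp
  then have "l ^ (j - i) = 1" using ij(2) assms(2) by simp
  then show ?thesis using ij(1) by (intro exI[of _ "j - i"]) simp
qed

text \<open>The eigenvalues are mutually inverse, so \<open>A\<close> and \<open>l\<close> have the
  same order and \<open>n\<close> to \<open>l ^ n\<close> is injective on \<open>{1..t}\<close>. The
  two eigenvectors yield the equations of the sums and of the inverse sums.\<close>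

lemma F2_le_of_eigenpairs:
  fixes x y z w :: "'a::field"
  assumes fin: "finite (UNIV :: 'a set)" and p: "CHAR('a) = p" "prime p" and A: "A \<in> SL2 (Fp p)"
    and ind: "x * w - y * z \<noteq> 0"
    and eig: "eigenpair A (x, y) l" "eigenpair A (z, w) m"
  shows "real (F2 p A) \<le> 28 * (real (mat2_order (Fp p) A) powr (11 / 3) +
    real (mat2_order (Fp p) A) ^ 5 / real p)"
proof -
  define M where "M = mat2_ring (Fp p)"
  define t where "t = mat2_order (Fp p) A"
  have lm: "l * m = 1" using SL2_eigenvalues_inverse[OF p A ind eig] .
  then have l0: "l \<noteq> 0" by auto
  have m: "m = inverse l" using lm by (metis inverse_unique)
  have "p > 0" using p(2) by (rule prime_gt_0_nat)
  have one_carrier: "\<one>\<^bsub>mat2_ring (Fp p)\<^esub> \<in> carrier (mat2_ring (Fp p))"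
    using p(2) prime_gt_1_nat[of p] by (simp add: mat2_ring_def mat2_diag_def residue_ring_def)
  have nz: "(x, y) \<noteq> (0, 0)" "(z, w) \<noteq> (0, 0)" using ind by auto
  have pow: "eigenpair (A [^]\<^bsub>M\<^esub> n) (x, y) (l ^ n)" "eigenpair (A [^]\<^bsub>M\<^esub> n) (z, w) (m ^ n)" for n :: nat
    unfolding M_def using eigenpair_pow[OF p(1)] eig by auto
  have pow_one: "A [^]\<^bsub>M\<^esub> n = \<one>\<^bsub>M\<^esub> \<longleftrightarrow> l ^ n = 1" if "n > 0" for n :: nat
  proof
    assume "A [^]\<^bsub>M\<^esub> n = \<one>\<^bsub>M\<^esub>"
    then have "eigenpair (\<one>\<^bsub>M\<^esub>) (x, y) (l ^ n)" using pow(1)[of n] by simp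
    then show "l ^ n = 1"
      using eigenpair_unique[OF _ eigenpair_one nz(1)] unfolding M_def by blast
  next
    assume l: "l ^ n = 1"
    then have "m ^ n = 1" by (simp add: m power_inverse)
    then show "A [^]\<^bsub>M\<^esub> n = \<one>\<^bsub>M\<^esub>"
      using pow[of n] l mat2_pow_closed[OF \<open>p > 0\<close> that, of A] unfolding M_def
      by (intro eigenpairs_determine_matrix[OF p(1) _ one_carrier ind _ _ eigenpair_one eigenpair_one])
         auto
  qed
  \<comment> \<open>Some positive exponent must exist for the \<open>LEAST\<close> in
    \<open>mat2_order\<close> to be meaningful.\<close>
  have "\<exists>n::nat. 1 \<le> n \<and> A [^]\<^bsub>M\<^esub> n = \<one>\<^bsub>M\<^esub>"
  proof -
    obtain n where "n > 0" "l ^ n = 1" using finite_field_power_eq_1[OF fin l0] by blast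
    then show ?thesis using pow_one by (intro exI[of _ n]) simp
  qed
  from LeastI_ex[OF this] have t: "1 \<le> t" "A [^]\<^bsub>M\<^esub> t = \<one>\<^bsub>M\<^esub>"
    unfolding t_def mat2_order_def M_def by auto
  have min: "t \<le> n" if "n > 0" "l ^ n = 1" for n
    unfolding t_def mat2_order_def using that pow_one[of n] by (intro Least_le) (simp add: M_def)
  have lt: "l ^ t = 1" using t pow_one[of t] by simp
  have inj: "i = j" if "i \<in> {1..t}" "j \<in> {1..t}" "l ^ i = l ^ j" for i j
  proof -
    have le: "j \<le> i" if "i \<in> {1..t}" "j \<in> {1..t}" "l ^ i = l ^ j" for i j
    proof (rule ccontr)
      assume "\<not> j \<le> i"
      then have "l ^ j = l ^ i * l ^ (j - i)" using power_add[of l i "j - i"] by simp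
      then have "l ^ (j - i) = 1" using that(3) l0 by simp
      then have "t \<le> j - i" using min[of "j - i"] \<open>\<not> j \<le> i\<close> by simp
      then show False using that \<open>\<not> j \<le> i\<close> by simp
    qed
    show ?thesis using le[of i j] le[of j i] that by simp
  qed
  define X where "X = {(x1 :: nat, x2 :: nat, x3 :: nat, x4 :: nat, x5 :: nat, x6 :: nat).
       {x1, x2, x3, x4, x5, x6} \<subseteq> {1..t} \<and>
       A [^]\<^bsub>M\<^esub> x1 \<oplus>\<^bsub>M\<^esub> A [^]\<^bsub>M\<^esub> x2 \<oplus>\<^bsub>M\<^esub> A [^]\<^bsub>M\<^esub> x3 =
       A [^]\<^bsub>M\<^esub> x4 \<oplus>\<^bsub>M\<^esub> A [^]\<^bsub>M\<^esub> x5 \<oplus>\<^bsub>M\<^esub> A [^]\<^bsub>M\<^esub> x6}"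
  define f where "f = (\<lambda>(x1 :: nat, x2 :: nat, x3 :: nat, x4 :: nat, x5 :: nat, x6 :: nat).
       ((l ^ x1, l ^ x2, l ^ x3), (l ^ x4, l ^ x5, l ^ x6)))"
  have "inj_on f X" unfolding inj_on_def X_def f_def by (auto intro: inj)
  moreover have "f ` X \<subseteq> unity_pairs t"
  proof (rule image_subsetI)
    fix q assume "q \<in> X"
    moreover obtain x1 x2 x3 x4 x5 x6 where q: "q = (x1, x2, x3, x4, x5, x6)" by (cases q)
    ultimately have eq: "A [^]\<^bsub>M\<^esub> x1 \<oplus>\<^bsub>M\<^esub> A [^]\<^bsub>M\<^esub> x2 \<oplus>\<^bsub>M\<^esub> A [^]\<^bsub>M\<^esub> x3 =
       A [^]\<^bsub>M\<^esub> x4 \<oplus>\<^bsub>M\<^esub> A [^]\<^bsub>M\<^esub> x5 \<oplus>\<^bsub>M\<^esub> A [^]\<^bsub>M\<^esub> x6" by (simp add: X_def)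
    \<comment> \<open>Both sides of the matrix equation have the eigenvector \<open>v\<close>; this
      is used for \<open>k = l\<close> and for \<open>k = m\<close>.\<close>
    have sum: "k ^ x1 + k ^ x2 + k ^ x3 = k ^ x4 + k ^ x5 + k ^ x6"
      if "\<And>n::nat. eigenpair (A [^]\<^bsub>M\<^esub> n) v (k ^ n)" "v \<noteq> (0, 0)" for k :: 'a and v
    proof (rule eigenpair_unique[OF _ _ that(2)])
      show "eigenpair (A [^]\<^bsub>M\<^esub> x1 \<oplus>\<^bsub>M\<^esub> A [^]\<^bsub>M\<^esub> x2 \<oplus>\<^bsub>M\<^esub> A [^]\<^bsub>M\<^esub> x3) v (k ^ x1 + k ^ x2 + k ^ x3)"
        using that(1) unfolding M_def by (intro eigenpair_add[OF p(1)])
      show "eigenpair (A [^]\<^bsub>M\<^esub> x1 \<oplus>\<^bsub>M\<^esub> A [^]\<^bsub>M\<^esub> x2 \<oplus>\<^bsub>M\<^esub> A [^]\<^bsub>M\<^esub> x3) v (k ^ x4 + k ^ x5 + k ^ x6)"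
        using that(1) unfolding eq unfolding M_def by (intro eigenpair_add[OF p(1)])
    qed
    have "(l ^ n) ^ t = 1" for n
      by (metis lt mult.commute power_mult power_one)
    then show "f q \<in> unity_pairs t"
      using sum[OF pow(1) nz(1)] sum[OF pow(2) nz(2)]
      by (simp add: q f_def unity_pairs_def unity_triples_def m power_inverse)
  qed
  ultimately have "card X \<le> card (unity_pairs t :: (('a \<times> 'a \<times> 'a) \<times> ('a \<times> 'a \<times> 'a)) set)"
    using card_unity_pairs(1)[of t, where 'a = 'a] t \<open>p > 0\<close> p(1) by (intro card_inj_on_le) auto
  moreover have "F2 p A = card X" by (simp add: F2_def X_def t_def M_def Let_def)
  ultimately show ?thesis
    using card_unity_pairs(2)[of t, where 'a = 'a] t \<open>p > 0\<close> p(1) unfolding t_def[symmetric] by simp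
qed

section \<open>A type for the field of the theorem\<close>

text \<open>The explicit constant keeps the bound independent of the field that is later chosen
  among its violations.\<close>

definition violates_bound :: "int ring \<Rightarrow> nat \<Rightarrow> int mat2 \<Rightarrow> (int \<Rightarrow> int) \<Rightarrow> bool" where
  "violates_bound K p A h \<longleftrightarrow> prime p \<and> A \<in> SL2 (Fp p) \<and> quadratic_extension p K h \<and>
     mat2_diagonalisable K (map_mat2 h A) \<and>
     \<not> real (F2 p A) \<le> 28 * (real (mat2_order (Fp p) A) powr (11 / 3) +
       real (mat2_order (Fp p) A) ^ 5 / real p)"

text \<open>
  Polynomials over a field are available for types of class \<open>field\<close> only, and a type cannot
  depend on the field given in the theorem. So one type is made, out of a field violating the
  bound if there is one, and the bound is proved for that type; \<open>residue_ring 2\<close> is a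
  default value.
\<close>

definition test_field :: "int ring" where
  "test_field = (if \<exists>K p A h. violates_bound K p A h then SOME K. \<exists>p A h. violates_bound K p A h
     else residue_ring 2)"

lemma test_field_violates:
  assumes ex: "\<exists>K p A h. violates_bound K p A h"
  shows "\<exists>p A h. violates_bound test_field p A h"
  unfolding test_field_def if_P[OF ex] by (rule someI_ex[OF ex])

lemma field_test_field: "field test_field"
proof (cases "\<exists>K p A h. violates_bound K p A h")
  case True
  from test_field_violates[OF this] show ?thesis
    by (auto simp: violates_bound_def quadratic_extension_def)
next
  case False
  interpret residues_prime 2 "residue_ring (int 2)" by (rule residues_prime.intro) simp_all
  show ?thesis using False is_field by (simp add: test_field_def)
qed

interpretation tf: field test_field by (rule field_test_field)

typedef test_elem = "carrier test_field"
  by (intro exI[of _ "\<zero>\<^bsub>test_field\<^esub>"]) simp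

setup_lifting type_definition_test_elem

instantiation test_elem :: field
begin

lift_definition zero_test_elem :: test_elem is "\<zero>\<^bsub>test_field\<^esub>" by simp
lift_definition one_test_elem :: test_elem is "\<one>\<^bsub>test_field\<^esub>" by simp
lift_definition plus_test_elem :: "test_elem \<Rightarrow> test_elem \<Rightarrow> test_elem"
  is "\<lambda>x y. x \<oplus>\<^bsub>test_field\<^esub> y" by simp
lift_definition times_test_elem :: "test_elem \<Rightarrow> test_elem \<Rightarrow> test_elem"
  is "\<lambda>x y. x \<otimes>\<^bsub>test_field\<^esub> y" by simp
lift_definition uminus_test_elem :: "test_elem \<Rightarrow> test_elem"
  is "\<lambda>x. \<ominus>\<^bsub>test_field\<^esub> x" by simp
lift_definition minus_test_elem :: "test_elem \<Rightarrow> test_elem \<Rightarrow> test_elem"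
  is "\<lambda>x y. x \<ominus>\<^bsub>test_field\<^esub> y" by simp
text \<open>The class \<open>field\<close> demands \<open>inverse 0 = 0\<close>, while
  \<open>inv\<close> is unspecified at zero.\<close>

lift_definition inverse_test_elem :: "test_elem \<Rightarrow> test_elem"
  is "\<lambda>x. if x = \<zero>\<^bsub>test_field\<^esub> then \<zero>\<^bsub>test_field\<^esub> else inv\<^bsub>test_field\<^esub> x"
  by (auto simp: tf.field_Units)
definition divide_test_elem :: "test_elem \<Rightarrow> test_elem \<Rightarrow> test_elem" where
  "divide_test_elem x y = x * inverse y"

instance
proof
  fix a b c :: test_elem
  show "a + b + c = a + (b + c)" by transfer (rule tf.a_assoc)
  show "a + b = b + a" by transfer (rule tf.a_comm)
  show "0 + a = a" by transfer simp
  show "- a + a = 0" by transfer (rule tf.l_neg)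
  show "a - b = a + - b" by transfer (simp add: a_minus_def)
  show "a * b * c = a * (b * c)" by transfer (rule tf.m_assoc)
  show "a * b = b * a" by transfer (rule tf.m_comm)
  show "1 * a = a" by transfer simp
  show "(a + b) * c = a * c + b * c" by transfer (rule tf.l_distr)
  show "(0 :: test_elem) \<noteq> 1" by transfer simp
  show "inverse a * a = 1" if "a \<noteq> 0" using that by transfer (auto simp: tf.field_Units)
  show "a div b = a * inverse b" by (rule divide_test_elem_def)
  show "inverse (0 :: test_elem) = 0" by transfer simp
qed

end

section \<open>Diagonalisable matrices and their transport to the type\<close>

lemma mat2_ring_monoid:
  assumes "cring R"
  shows "monoid (mat2_ring R)"
proof -
  interpret cring R by fact
  show ?thesis
  proof (rule monoidI)
    fix A B C assume "A \<in> carrier (mat2_ring R)" "B \<in> carrier (mat2_ring R)" "C \<in> carrier (mat2_ring R)"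
    then show "A \<otimes>\<^bsub>mat2_ring R\<^esub> B \<otimes>\<^bsub>mat2_ring R\<^esub> C = A \<otimes>\<^bsub>mat2_ring R\<^esub> (B \<otimes>\<^bsub>mat2_ring R\<^esub> C)"
      by (cases A; cases B; cases C) (simp add: mat2_ring_def l_distr r_distr m_assoc a_ac)
  next
    fix A B assume "A \<in> carrier (mat2_ring R)" "B \<in> carrier (mat2_ring R)"
    then show "A \<otimes>\<^bsub>mat2_ring R\<^esub> B \<in> carrier (mat2_ring R)"
      by (cases A; cases B) (simp add: mat2_ring_def)
  next
    fix A assume "A \<in> carrier (mat2_ring R)"
    then show "\<one>\<^bsub>mat2_ring R\<^esub> \<otimes>\<^bsub>mat2_ring R\<^esub> A = A" "A \<otimes>\<^bsub>mat2_ring R\<^esub> \<one>\<^bsub>mat2_ring R\<^esub> = A"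
      by (cases A, simp add: mat2_ring_def mat2_diag_def)+
  qed (simp add: mat2_ring_def mat2_diag_def)
qed

text \<open>In the form \<open>A P = P D\<close> with a right inverse \<open>Q\<close> of
  \<open>P\<close>, diagonalisability can be read off entry by entry.\<close>

lemma mat2_diagonalisableD:
  assumes "cring R" "mat2_diagonalisable R A" "A \<in> carrier (mat2_ring R)"
  obtains P Q l m where "P \<in> carrier (mat2_ring R)" "Q \<in> carrier (mat2_ring R)"
    "l \<in> carrier R" "m \<in> carrier R"
    "mat2_mult R P Q = mat2_diag R \<one>\<^bsub>R\<^esub> \<one>\<^bsub>R\<^esub>"
    "mat2_mult R A P = mat2_mult R P (mat2_diag R l m)"
proof -
  interpret M: monoid "mat2_ring R" using assms(1) by (rule mat2_ring_monoid)
  obtain P l m where P: "P \<in> Units (mat2_ring R)" "l \<in> carrier R" "m \<in> carrier R"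
    "inv\<^bsub>mat2_ring R\<^esub> P \<otimes>\<^bsub>mat2_ring R\<^esub> A \<otimes>\<^bsub>mat2_ring R\<^esub> P = mat2_diag R l m"
    using assms(2) by (auto simp: mat2_diagonalisable_def)
  define Q where "Q = inv\<^bsub>mat2_ring R\<^esub> P"
  have PQ: "P \<in> carrier (mat2_ring R)" "Q \<in> carrier (mat2_ring R)"
    "P \<otimes>\<^bsub>mat2_ring R\<^esub> Q = \<one>\<^bsub>mat2_ring R\<^esub>"
    using P(1) by (simp_all add: Q_def M.Units_closed)
  have "P \<otimes>\<^bsub>mat2_ring R\<^esub> mat2_diag R l m = P \<otimes>\<^bsub>mat2_ring R\<^esub> (Q \<otimes>\<^bsub>mat2_ring R\<^esub> A \<otimes>\<^bsub>mat2_ring R\<^esub> P)"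
    using P(4) by (simp add: Q_def)
  also have "\<dots> = (P \<otimes>\<^bsub>mat2_ring R\<^esub> Q) \<otimes>\<^bsub>mat2_ring R\<^esub> A \<otimes>\<^bsub>mat2_ring R\<^esub> P"
    using PQ(1,2) assms(3) by (simp add: M.m_assoc)
  also have "\<dots> = A \<otimes>\<^bsub>mat2_ring R\<^esub> P" using PQ assms(3) by simp
  finally show thesis using that[OF PQ(1,2) P(2,3)] PQ(3) by (simp add: mat2_ring_def)
qed

text \<open>\<open>Abs_test_elem\<close> carries the field operations to the type and turns
  \<open>h\<close> on residues into \<open>of_int\<close>. The columns of \<open>P\<close> become
  independent eigenvectors, and \<open>F2_le_of_eigenpairs\<close> applies.\<close>

lemma no_violation_in_test_field: "\<not> violates_bound test_field p A h"
proof
  assume "violates_bound test_field p A h"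
  then have p: "prime p" and A: "A \<in> SL2 (Fp p)" and ext: "quadratic_extension p test_field h"
    and diag: "mat2_diagonalisable test_field (map_mat2 h A)"
    and viol: "\<not> real (F2 p A) \<le> 28 * (real (mat2_order (Fp p) A) powr (11 / 3) +
       real (mat2_order (Fp p) A) ^ 5 / real p)"
    by (auto simp: violates_bound_def)
  have hom: "h \<in> ring_hom (Fp p) test_field" using ext by (simp add: quadratic_extension_def)
  have p1: "p > 1" using p by (rule prime_gt_1_nat)
  have "card (carrier test_field) = p ^ 2" using ext by (simp add: quadratic_extension_def)
  then have "finite (carrier test_field)" using p1 by (simp add: card_ge_0_finite)
  then have fin: "finite (UNIV :: test_elem set)"
    unfolding type_definition.Abs_image[OF type_definition_test_elem, symmetric] by simp
  have h_closed: "h i \<in> carrier test_field" if "i \<in> {0..int p - 1}" for i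
    using ring_hom_closed[OF hom, of i] that by (simp add: residue_ring_def)
  \<comment> \<open>The residue keeps the argument of \<open>h\<close> in its domain;
    \<open>n = p\<close> then yields the characteristic.\<close>
  have h_nat: "Abs_test_elem (h (int n mod int p)) = of_nat n" for n
  proof (induction n)
    case 0
    \<comment> \<open>\<open>h 0\<close> is idempotent for addition, hence zero.\<close>
    have "h 0 \<oplus>\<^bsub>test_field\<^esub> h 0 = h 0"
      using ring_hom_add[OF hom, of 0 0] p1 by (simp add: residue_ring_def)
    then have "h 0 = \<zero>\<^bsub>test_field\<^esub>"
      using h_closed[of 0] p1 by (simp add: tf.add.l_cancel_one)
    then show ?case by (simp add: zero_test_elem_def)
  next
    case (Suc n)
    have range: "int n mod int p \<in> {0..int p - 1}" "1 \<in> {0..int p - 1}" using p1 by auto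
    have "int (Suc n) mod int p = (int n mod int p + 1) mod int p"
      using mod_add_left_eq[of "int n" "int p" 1] by (simp add: add.commute)
    then have "h (int (Suc n) mod int p) = h (int n mod int p) \<oplus>\<^bsub>test_field\<^esub> h 1"
      using ring_hom_add[OF hom, of "int n mod int p" 1] range by (simp add: residue_ring_def)
    also have "h 1 = \<one>\<^bsub>test_field\<^esub>" using ring_hom_one[OF hom] by (simp add: residue_ring_def)
    finally show ?case
      using Suc h_closed[OF range(1)]
      by (simp add: plus_test_elem.abs_eq one_test_elem_def eq_onp_def tf.a_comm flip: Suc)
  qed
  have "of_nat p = (0 :: test_elem)" using h_nat[of p] h_nat[of 0] by simp
  then have "CHAR(test_elem) dvd p" by (simp add: of_nat_eq_0_iff_char_dvd)
  then have CHAR: "CHAR(test_elem) = p" using p CHAR_not_1'[where 'a = test_elem]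
    by (metis One_nat_def prime_nat_iff)
  have h_int: "Abs_test_elem (h i) = of_int i" if "i \<in> {0..int p - 1}" for i
    using h_nat[of "nat i"] that by simp

  obtain a b c d where A': "A = Mat2 a b c d" by (cases A)
  have entries: "{a, b, c, d} \<subseteq> {0..int p - 1}"
    using A by (simp add: A' SL2_def mat2_ring_def residue_ring_def)
  define A1 where "A1 = map_mat2 h A"
  have A1: "A1 = Mat2 (h a) (h b) (h c) (h d)" by (simp add: A1_def A')
  have "A1 \<in> carrier (mat2_ring test_field)"
    using h_closed entries by (simp add: A1 mat2_ring_def)
  from mat2_diagonalisableD[OF tf.is_cring diag[folded A1_def] this] obtain P Q l m where
    PQ: "P \<in> carrier (mat2_ring test_field)" "Q \<in> carrier (mat2_ring test_field)"
    "l \<in> carrier test_field" "m \<in> carrier test_field"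
    "mat2_mult test_field P Q = mat2_diag test_field \<one>\<^bsub>test_field\<^esub> \<one>\<^bsub>test_field\<^esub>"
    "mat2_mult test_field A1 P = mat2_mult test_field P (mat2_diag test_field l m)" .
  \<comment> \<open>The names make \<open>(x, y)\<close> and \<open>(z, w)\<close> the columns of
    \<open>P\<close>.\<close>
  obtain x z y w where P: "P = Mat2 x z y w" by (cases P)
  obtain x' z' y' w' where Q: "Q = Mat2 x' z' y' w'" by (cases Q)
  have carr: "{x, y, z, w, x', y', z', w'} \<subseteq> carrier test_field"
    using PQ(1,2) by (simp add: P Q mat2_ring_def)
  have one: "x \<otimes>\<^bsub>test_field\<^esub> x' \<oplus>\<^bsub>test_field\<^esub> z \<otimes>\<^bsub>test_field\<^esub> y' = \<one>\<^bsub>test_field\<^esub>"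
    "x \<otimes>\<^bsub>test_field\<^esub> z' \<oplus>\<^bsub>test_field\<^esub> z \<otimes>\<^bsub>test_field\<^esub> w' = \<zero>\<^bsub>test_field\<^esub>"
    "y \<otimes>\<^bsub>test_field\<^esub> x' \<oplus>\<^bsub>test_field\<^esub> w \<otimes>\<^bsub>test_field\<^esub> y' = \<zero>\<^bsub>test_field\<^esub>"
    "y \<otimes>\<^bsub>test_field\<^esub> z' \<oplus>\<^bsub>test_field\<^esub> w \<otimes>\<^bsub>test_field\<^esub> w' = \<one>\<^bsub>test_field\<^esub>"
    using PQ(5) by (simp_all add: P Q mat2_diag_def)
  define \<alpha> where "\<alpha> = Abs_test_elem"
  have \<alpha>: "\<alpha> (u \<oplus>\<^bsub>test_field\<^esub> v) = \<alpha> u + \<alpha> v" "\<alpha> (u \<otimes>\<^bsub>test_field\<^esub> v) = \<alpha> u * \<alpha> v"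
    if "u \<in> carrier test_field" "v \<in> carrier test_field" for u v
    using that unfolding \<alpha>_def by (simp_all add: plus_test_elem.abs_eq times_test_elem.abs_eq eq_onp_def)
  have \<alpha>01: "\<alpha> \<zero>\<^bsub>test_field\<^esub> = 0" "\<alpha> \<one>\<^bsub>test_field\<^esub> = 1"
    by (simp_all add: \<alpha>_def zero_test_elem_def one_test_elem_def)
  have "\<alpha> x * \<alpha> x' + \<alpha> z * \<alpha> y' = 1" "\<alpha> x * \<alpha> z' + \<alpha> z * \<alpha> w' = 0"
    "\<alpha> y * \<alpha> x' + \<alpha> w * \<alpha> y' = 0" "\<alpha> y * \<alpha> z' + \<alpha> w * \<alpha> w' = 1"
    using one[THEN arg_cong[of _ _ \<alpha>]] carr by (simp_all add: \<alpha> \<alpha>01)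
  \<comment> \<open>This is \<open>det P * det Q = det (P Q)\<close>; it makes the columns of
    \<open>P\<close> independent.\<close>
  moreover have "(\<alpha> x * \<alpha> w - \<alpha> y * \<alpha> z) * (\<alpha> x' * \<alpha> w' - \<alpha> y' * \<alpha> z') =
      (\<alpha> x * \<alpha> x' + \<alpha> z * \<alpha> y') * (\<alpha> y * \<alpha> z' + \<alpha> w * \<alpha> w') -
      (\<alpha> x * \<alpha> z' + \<alpha> z * \<alpha> w') * (\<alpha> y * \<alpha> x' + \<alpha> w * \<alpha> y')"
    by (simp add: algebra_simps)
  ultimately have ind: "\<alpha> x * \<alpha> w - \<alpha> y * \<alpha> z \<noteq> 0" by auto
  have "h a \<otimes>\<^bsub>test_field\<^esub> x \<oplus>\<^bsub>test_field\<^esub> h b \<otimes>\<^bsub>test_field\<^esub> y = x \<otimes>\<^bsub>test_field\<^esub> l"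
    "h c \<otimes>\<^bsub>test_field\<^esub> x \<oplus>\<^bsub>test_field\<^esub> h d \<otimes>\<^bsub>test_field\<^esub> y = y \<otimes>\<^bsub>test_field\<^esub> l"
    "h a \<otimes>\<^bsub>test_field\<^esub> z \<oplus>\<^bsub>test_field\<^esub> h b \<otimes>\<^bsub>test_field\<^esub> w = z \<otimes>\<^bsub>test_field\<^esub> m"
    "h c \<otimes>\<^bsub>test_field\<^esub> z \<oplus>\<^bsub>test_field\<^esub> h d \<otimes>\<^bsub>test_field\<^esub> w = w \<otimes>\<^bsub>test_field\<^esub> m"
    using PQ(3,4,6) carr h_closed entries by (simp_all add: P A1 mat2_diag_def)
  note this[THEN arg_cong[of _ _ \<alpha>]]
  then have "eigenpair A (\<alpha> x, \<alpha> y) (\<alpha> l)" "eigenpair A (\<alpha> z, \<alpha> w) (\<alpha> m)"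
    using PQ(3,4) carr h_closed entries h_int[folded \<alpha>_def]
    by (simp_all add: A' \<alpha> mult.commute)
  with F2_le_of_eigenpairs[OF fin CHAR p A ind] viol show False by blast
qed

text \<open>A violation over any field would make \<open>test_field\<close> a violating field
  too.\<close>

lemma no_violation: "\<not> violates_bound K p A h"
proof
  assume "violates_bound K p A h"
  then have "\<exists>K p A h. violates_bound K p A h" by blast
  from test_field_violates[OF this] no_violation_in_test_field show False by blast
qed

theorem theorem2p3:
  "\<exists>c :: real. c > 0 \<and>
     (\<forall>(p :: nat) (A :: int mat2) (K :: int ring) (h :: int \<Rightarrow> int).
        prime p \<longrightarrow>
        A \<in> SL2 (Fp p) \<longrightarrow>
        quadratic_extension p K h \<longrightarrow>
        mat2_diagonalisable K (map_mat2 h A) \<longrightarrow>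
        (\<forall>l. mat2_eigenvalue K (map_mat2 h A) l \<longrightarrow>
               l \<in> (carrier K - {\<zero>\<^bsub>K\<^esub>}) - h ` carrier (Fp p)) \<longrightarrow>
        real (F2 p A) \<le>
          c * (real (mat2_order (Fp p) A) powr (19 / 5) +
               real (mat2_order (Fp p) A) ^ 5 / real p))"
proof (intro exI[of _ 28] conjI allI impI)
  fix p A K h
  assume "prime p" "A \<in> SL2 (Fp p)" "quadratic_extension p K h"
    "mat2_diagonalisable K (map_mat2 h A)"
  then have "real (F2 p A) \<le> 28 * (real (mat2_order (Fp p) A) powr (11 / 3) +
      real (mat2_order (Fp p) A) ^ 5 / real p)"
    using no_violation[of K p A h] by (auto simp: violates_bound_def)
  \<comment> \<open>Monotonicity in the exponent needs a base of at least 1; for base 0 both powers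
    are 0.\<close>
  also have "real (mat2_order (Fp p) A) powr (11 / 3) \<le> real (mat2_order (Fp p) A) powr (19 / 5)"
    by (cases "mat2_order (Fp p) A = 0") (auto intro!: powr_mono)
  finally show "real (F2 p A) \<le> 28 * (real (mat2_order (Fp p) A) powr (19 / 5) +
      real (mat2_order (Fp p) A) ^ 5 / real p)" by simp
qed simp

end
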